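(* Let $\mathcal E$ be an ES and $>$ a $\mathcal B$-compatible reduction order. For every fair and non-failing run $(\mathcal E_0,\mathcal R_0)\vdash_{\mathcal I_A}(\mathcal E_1,\mathcal R_1)\vdash_{\mathcal I_A}\cdots\vdash_{\mathcal I_A}(\mathcal E_n,\mathcal R_n)$ for $\mathcal E$, the TRS $\mathcal R_n$ is a $\mathcal B$-complete representation of $\mathcal E$: $\leftrightarrow^*_{\mathcal E\cup\mathcal B}=\leftrightarrow^*_{\mathcal R_n\cup\mathcal B}$, $\mathcal R_n$ is terminating modulo $\mathcal B$, and $\mathcal R_n$ is Church–Rosser modulo $\mathcal B$.
   Context: Terms over a signature $\mathcal F$ and variables. A rule $\ell\to r$: $\ell$ not a variable, $\mathrm{Var}(r)\subseteq\mathrm{Var}(\ell)$. For a set $\mathcal E$ of pairs of terms (equations and rules read as oriented pairs), $s\to_{\mathcal E}t$ iff $s|_p=\ell\sigma$, $t=s[r\sigma]_p$ for some $(\ell,r)\in\mathcal E$, position $p$, substitution $\sigma$; $\leftarrow$ is the inverse, $\leftrightarrow$ the symmetric closure. $\mathcal B$ is a fixed ES with $\mathrm{Var}(\ell)=\mathrm{Var}(r)$ for all $\ell\approx r\in\mathcal B$; $\sim_{\mathcal B}=\leftrightarrow^*_{\mathcal B}$, $\mathcal B^\pm=\mathcal B\cup\{t\approx s\mid s\approx t\in\mathcal B\}$; $\to_{\mathcal R/\mathcal B}=\sim_{\mathcal B}\cdot\to_{\mathcal R}\cdot\sim_{\mathcal B}$; $s\downarrow^\sim_{\mathcal R}t$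 iff $s\to^*_{\mathcal R}\cdot\sim_{\mathcal B}\cdot\leftarrow^*_{\mathcal R}t$. $\mathcal R$ is terminating modulo $\mathcal B$ if $\to_{\mathcal R/\mathcal B}$ admits no infinite sequence, Church–Rosser modulo $\mathcal B$ if $\leftrightarrow^*_{\mathcal R\cup\mathcal B}\subseteq\downarrow^\sim_{\mathcal R}$. A $\mathcal B$-compatible reduction order is a well-founded order on terms closed under contexts and substitutions with $\sim_{\mathcal B}\cdot>\cdot\sim_{\mathcal B}\subseteq>$. Inference system $\mathcal I_A$ (parameterized by $>$) on pairs $(\mathcal E,\mathcal R)$ ($\uplus$ disjoint union, $s\approx^\pm t$ means $s\approx t$ or $t\approx s$): Deduce (peak): $(\mathcal E,\mathcal R)\vdash(\mathcal E\cup\{s\approx t\},\mathcal R)$ if $s\leftarrow_{\mathcal R}\cdot\to_{\mathcal R}t$. Deduce (cliff): $(\mathcal E,\mathcal R)\vdash(\mathcal E,\mathcal R\cup\{t\to s\})$ if $s\leftarrow_{\mathcal R}\cdot\leftrightarrow_{\mathcal B}t$. Orient: $(\mathcal E\uplus\{s\approx^\pm t\},\mathcal R)\vdash(\mathcal E,\mathcal R\cup\{s\to t\})$ if $s>t$. Delete: $(\mathcal E\uplus\{s\approx t\},\mathcal R)\vdash(\mathcal E,\mathcal R)$ if $s\sim_{\mathcal B}t$. Simplify: $(\mathcal E\uplus\{s\approx^\pm t\},\mathcal R)\vdash(\mathcal E\cup\{u\approx t\},\mathcal R)$ if $s\to_{\mathcal R/\mathcal B}u$. Collapse: $(\mathcal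 E,\mathcal R\uplus\{s\to t\})\vdash(\mathcal E\cup\{u\approx t\},\mathcal R)$ if $s\to_{\mathcal R}u$. Compose: $(\mathcal E,\mathcal R\uplus\{s\to t\})\vdash(\mathcal E,\mathcal R\cup\{s\to u\})$ if $t\to_{\mathcal R/\mathcal B}u$. A run for $\mathcal E$ is a finite sequence of $\mathcal I_A$-steps from $(\mathcal E_0,\mathcal R_0)=(\mathcal E,\varnothing)$ to $(\mathcal E_n,\mathcal R_n)$; it fails if $\mathcal E_n\neq\varnothing$. It is fair if $\mathcal R_n$ is left-linear and $\mathrm{PCP}(\mathcal R_n)\subseteq\ \downarrow^\sim_{\mathcal R_n}\cup\bigcup_{i=0}^n\leftrightarrow_{\mathcal E_i\cup\mathcal R_i}$ and $\mathrm{PCP}^\pm(\mathcal R_n,\mathcal B^\pm)\subseteq\ \downarrow^\sim_{\mathcal R_n}\cup\bigcup_{i=0}^n\leftrightarrow_{\mathcal R_i}$. Critical pairs: for sets of oriented pairs $\mathcal R_1,\mathcal R_2$ (equations of $\mathcal B^\pm$ read as oriented pairs), an overlap is $\langle\ell_1\to r_1,p,\ell_2\to r_2\rangle$ with $\ell_i\to r_i$ variants of elements of $\mathcal R_i$ without common variables, $p$ a non-variable position of $\ell_2$, $\ell_1$ and $\ell_2|_p$ unifiable, and the two rules not variants if $p=\epsilon$; with an mgu $\sigma$ it yields the critical peak $\ell_2\sigma[r_1\sigma]_p\leftarrow^p\ell_2\sigma\to^\epsilon r_2\sigma$ and critical pair $\ell_2\sigma[r_1\sigma]_p\approx r_2\sigma$.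 The peak is prime if all proper subterms of $\ell_2\sigma|_p$ are normal forms w.r.t. the TRS $\mathcal R$ under consideration (also for overlaps involving $\mathcal B^\pm$). $\mathrm{PCP}(\mathcal R)$: prime critical pairs from overlaps of $\mathcal R$ with itself; $\mathrm{PCP}^\pm(\mathcal R,\mathcal B^\pm)$: prime critical pairs from overlaps between $\mathcal R$ and $\mathcal B^\pm$ in either order. *)

theory Defs
  imports Main
begin

datatype ('f, 'v) trm = Var 'v | Fun 'f "('f, 'v) trm list"

type_synonym ('f, 'v) rule = "('f, 'v) trm \<times> ('f, 'v) trm"

fun vars :: "('f, 'v) trm \<Rightarrow> 'v set" where
  "vars (Var x) = {x}"
| "vars (Fun f ts) = \<Union> (set (map vars ts))"

fun subst :: "('f, 'v) trm \<Rightarrow> ('v \<Rightarrow> ('f, 'v) trm) \<Rightarrow> ('f, 'v) trm" where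
  "subst (Var x) \<sigma> = \<sigma> x"
| "subst (Fun f ts) \<sigma> = Fun f (map (\<lambda>t. subst t \<sigma>) ts)"

function poss :: "('f, 'v) trm \<Rightarrow> nat list set" where
  "poss (Var x) = {[]}"
| "poss (Fun f ts) = insert [] (\<Union>i \<in> {..<length ts}. (Cons i) ` poss (ts ! i))"
  by pat_completeness auto
termination
  by (relation "measure size") (auto intro!: size_list_estimation' nth_mem le_imp_less_Suc)

fun subt_at :: "('f, 'v) trm \<Rightarrow> nat list \<Rightarrow> ('f, 'v) trm" where
  "subt_at t [] = t"
| "subt_at (Var x) (i # p) = Var x"
| "subt_at (Fun f ts) (i # p) = (if i < length ts then subt_at (ts ! i) p else Fun f ts)"

fun replace_at :: "('f, 'v) trm \<Rightarrow> nat list \<Rightarrow> ('f, 'v) trm \<Rightarrow> ('f, 'v) trm" where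
  "replace_at t [] s = s"
| "replace_at (Var x) (i # p) s = Var x"
| "replace_at (Fun f ts) (i # p) s =
     (if i < length ts then Fun f (ts[i := replace_at (ts ! i) p s]) else Fun f ts)"

fun linear :: "('f, 'v) trm \<Rightarrow> bool" where
  "linear (Var x) = True"
| "linear (Fun f ts) = ((\<forall>t \<in> set ts. linear t) \<and>
     (\<forall>i j. i < length ts \<longrightarrow> j < length ts \<longrightarrow> i \<noteq> j \<longrightarrow> vars (ts ! i) \<inter> vars (ts ! j) = {}))"

definition left_linear :: "('f, 'v) rule set \<Rightarrow> bool" where
  "left_linear R \<longleftrightarrow> (\<forall>(l, r) \<in> R. linear l)"

definition rstep :: "('f, 'v) rule set \<Rightarrow> ('f, 'v) trm rel" where
  "rstep R = {(s, t). \<exists>l r p \<sigma>. (l, r) \<in> R \<and> p \<in> poss s \<and> subt_at s p = subst l \<sigma>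
                  \<and> t = replace_at s p (subst r \<sigma>)}"

definition sstep :: "('f, 'v) rule set \<Rightarrow> ('f, 'v) trm rel" where
  "sstep R = rstep R \<union> (rstep R)\<inverse>"

definition conv :: "('f, 'v) rule set \<Rightarrow> ('f, 'v) trm rel" where
  "conv R = (sstep R)\<^sup>*"

definition simB :: "('f, 'v) rule set \<Rightarrow> ('f, 'v) trm rel" where
  "simB B = conv B"

definition Bpm :: "('f, 'v) rule set \<Rightarrow> ('f, 'v) rule set" where
  "Bpm B = B \<union> B\<inverse>"

definition rel_mod :: "('f, 'v) rule set \<Rightarrow> ('f, 'v) rule set \<Rightarrow> ('f, 'v) trm rel" where
  "rel_mod R B = simB B O rstep R O simB B"

definition join_mod :: "('f, 'v) rule set \<Rightarrow> ('f, 'v) rule set \<Rightarrow> ('f, 'v) trm rel" where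
  "join_mod R B = (rstep R)\<^sup>* O simB B O ((rstep R)\<inverse>)\<^sup>*"

definition SN_rel :: "'a rel \<Rightarrow> bool" where
  "SN_rel S \<longleftrightarrow> \<not> (\<exists>f. \<forall>i. (f i, f (Suc i)) \<in> S)"

definition terminating_mod :: "('f, 'v) rule set \<Rightarrow> ('f, 'v) rule set \<Rightarrow> bool" where
  "terminating_mod R B \<longleftrightarrow> SN_rel (rel_mod R B)"

definition CR_mod :: "('f, 'v) rule set \<Rightarrow> ('f, 'v) rule set \<Rightarrow> bool" where
  "CR_mod R B \<longleftrightarrow> conv (R \<union> B) \<subseteq> join_mod R B"

definition NF :: "('f, 'v) rule set \<Rightarrow> ('f, 'v) trm \<Rightarrow> bool" where
  "NF R t \<longleftrightarrow> (\<nexists>u. (t, u) \<in> rstep R)"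

definition B_compatible_reduction_order :: "('f, 'v) rule set \<Rightarrow> ('f, 'v) trm rel \<Rightarrow> bool" where
  "B_compatible_reduction_order B gt \<longleftrightarrow>
     irrefl gt \<and> trans gt \<and> SN_rel gt
   \<and> (\<forall>s t u p. (s, t) \<in> gt \<longrightarrow> p \<in> poss u \<longrightarrow> (replace_at u p s, replace_at u p t) \<in> gt)
   \<and> (\<forall>s t \<sigma>. (s, t) \<in> gt \<longrightarrow> (subst s \<sigma>, subst t \<sigma>) \<in> gt)
   \<and> simB B O gt O simB B \<subseteq> gt"

definition variant :: "('f, 'v) rule \<Rightarrow> ('f, 'v) rule \<Rightarrow> bool" where
  "variant \<rho> \<rho>' \<longleftrightarrow> (\<exists>\<pi>. bij \<pi> \<and> fst \<rho>' = subst (fst \<rho>) (Var \<circ> \<pi>) \<and> snd \<rho>' = subst (snd \<rho>) (Var \<circ> \<pi>))"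

definition is_mgu :: "('v \<Rightarrow> ('f, 'v) trm) \<Rightarrow> ('f, 'v) trm \<Rightarrow> ('f, 'v) trm \<Rightarrow> bool" where
  "is_mgu \<sigma> s t \<longleftrightarrow> subst s \<sigma> = subst t \<sigma> \<and>
     (\<forall>\<tau>. subst s \<tau> = subst t \<tau> \<longrightarrow> (\<exists>\<delta>. \<forall>x. \<tau> x = subst (\<sigma> x) \<delta>))"

definition rule_vars :: "('f, 'v) rule \<Rightarrow> 'v set" where
  "rule_vars \<rho> = vars (fst \<rho>) \<union> vars (snd \<rho>)"

definition overlap :: "('f, 'v) rule set \<Rightarrow> ('f, 'v) rule set \<Rightarrow>
    ('f, 'v) rule \<Rightarrow> nat list \<Rightarrow> ('f, 'v) rule \<Rightarrow> bool" where
  "overlap R1 R2 \<rho>1 p \<rho>2 \<longleftrightarrow>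
     (\<exists>\<rho> \<in> R1. variant \<rho> \<rho>1) \<and> (\<exists>\<rho> \<in> R2. variant \<rho> \<rho>2)
   \<and> rule_vars \<rho>1 \<inter> rule_vars \<rho>2 = {}
   \<and> p \<in> poss (fst \<rho>2) \<and> (\<nexists>x. subt_at (fst \<rho>2) p = Var x)
   \<and> (\<exists>\<tau>. subst (fst \<rho>1) \<tau> = subst (subt_at (fst \<rho>2) p) \<tau>)
   \<and> (p = [] \<longrightarrow> \<not> variant \<rho>1 \<rho>2)"

definition PCP_gen :: "('f, 'v) rule set \<Rightarrow> ('f, 'v) rule set \<Rightarrow> ('f, 'v) rule set \<Rightarrow> ('f, 'v) rule set" where
  "PCP_gen R R1 R2 = {(replace_at (subst (fst \<rho>2) \<sigma>) p (subst (snd \<rho>1) \<sigma>), subst (snd \<rho>2) \<sigma>) | \<rho>1 p \<rho>2 \<sigma>.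
      overlap R1 R2 \<rho>1 p \<rho>2 \<and> is_mgu \<sigma> (fst \<rho>1) (subt_at (fst \<rho>2) p)
    \<and> (\<forall>q \<in> poss (subt_at (subst (fst \<rho>2) \<sigma>) p). q \<noteq> [] \<longrightarrow>
          NF R (subt_at (subt_at (subst (fst \<rho>2) \<sigma>) p) q))}"

definition PCP :: "('f, 'v) rule set \<Rightarrow> ('f, 'v) rule set" where
  "PCP R = PCP_gen R R R"

definition PCP_pm :: "('f, 'v) rule set \<Rightarrow> ('f, 'v) rule set \<Rightarrow> ('f, 'v) rule set" where
  "PCP_pm R B = PCP_gen R R (Bpm B) \<union> PCP_gen R (Bpm B) R"

type_synonym ('f, 'v) state = "('f, 'v) rule set \<times> ('f, 'v) rule set"

inductive IA_step :: "('f, 'v) rule set \<Rightarrow> ('f, 'v) trm rel \<Rightarrow>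
    ('f, 'v) state \<Rightarrow> ('f, 'v) state \<Rightarrow> bool" for B gt where
  deduce_peak: "(s, t) \<in> (rstep R)\<inverse> O rstep R \<Longrightarrow>
     IA_step B gt (E, R) (E \<union> {(s, t)}, R)"
| deduce_cliff: "(s, t) \<in> (rstep R)\<inverse> O sstep B \<Longrightarrow>
     IA_step B gt (E, R) (E, R \<union> {(t, s)})"
| orient: "e \<in> E \<Longrightarrow> e = (s, t) \<or> e = (t, s) \<Longrightarrow> (s, t) \<in> gt \<Longrightarrow>
     IA_step B gt (E, R) (E - {e}, R \<union> {(s, t)})"
| delete: "(s, t) \<in> E \<Longrightarrow> (s, t) \<in> simB B \<Longrightarrow>
     IA_step B gt (E, R) (E - {(s, t)}, R)"
| simplify: "e \<in> E \<Longrightarrow> e = (s, t) \<or> e = (t, s) \<Longrightarrow> (s, u) \<in> rel_mod R B \<Longrightarrow>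
     IA_step B gt (E, R) ((E - {e}) \<union> {(u, t)}, R)"
| collapse: "(s, t) \<in> R \<Longrightarrow> (s, u) \<in> rstep (R - {(s, t)}) \<Longrightarrow>
     IA_step B gt (E, R) (E \<union> {(u, t)}, R - {(s, t)})"
| compose: "(s, t) \<in> R \<Longrightarrow> (t, u) \<in> rel_mod (R - {(s, t)}) B \<Longrightarrow>
     IA_step B gt (E, R) (E, (R - {(s, t)}) \<union> {(s, u)})"

definition is_run :: "('f, 'v) rule set \<Rightarrow> ('f, 'v) trm rel \<Rightarrow> ('f, 'v) rule set \<Rightarrow>
    (nat \<Rightarrow> ('f, 'v) state) \<Rightarrow> nat \<Rightarrow> bool" where
  "is_run B gt E run n \<longleftrightarrow> run 0 = (E, {}) \<and> (\<forall>i < n. IA_step B gt (run i) (run (Suc i)))"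

definition fails :: "(nat \<Rightarrow> ('f, 'v) state) \<Rightarrow> nat \<Rightarrow> bool" where
  "fails run n \<longleftrightarrow> fst (run n) \<noteq> {}"

definition fair :: "('f, 'v) rule set \<Rightarrow> (nat \<Rightarrow> ('f, 'v) state) \<Rightarrow> nat \<Rightarrow> bool" where
  "fair B run n \<longleftrightarrow> left_linear (snd (run n))
   \<and> PCP (snd (run n)) \<subseteq> join_mod (snd (run n)) B \<union> (\<Union>i \<le> n. sstep (fst (run i) \<union> snd (run i)))
   \<and> PCP_pm (snd (run n)) B \<subseteq> join_mod (snd (run n)) B \<union> (\<Union>i \<le> n. sstep (snd (run i)))"

end

theory Submission
  imports Defs "HOL-Library.Sublist" "HOL-Combinatorics.Transposition"
begin

text \<open>
  Call two terms connected below \<open>u\<close> if a conversion of the final system modulo \<open>B\<close> joins them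
  through terms that are all smaller than \<open>u\<close>. Going backwards along the run, equations of an
  intermediate system stay connected below every common upper bound, and each rule step \<open>s \<rightarrow> t\<close>
  is simulated by a step \<open>s \<rightarrow> s'\<close> of the final system with \<open>s'\<close> and \<open>t\<close> connected below \<open>s\<close>; no
  encompassment condition is needed on collapse because the run is finite. By fairness, every prime
  critical peak \<open>s \<leftarrow> u \<rightarrow> t\<close> is then connected below \<open>u\<close>, and every prime critical cliff, where
  \<open>u\<close> and \<open>t\<close> are related by a \<open>B\<close>-step, has a step \<open>t \<rightarrow> s'\<close> with \<open>s'\<close> connected to \<open>s\<close> below \<open>u\<close>.
  Variable and parallel overlaps are joinable modulo \<open>B\<close>, as left-hand sides are linear, and in a
  joinable cliff \<open>t\<close> must be reducible: \<open>t\<close> is equivalent to \<open>u\<close>, which exceeds every reduct of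
  \<open>s\<close>. A peak or cliff that is not prime is split at an innermost redex below both of its
  positions. Finally, well-founded induction on \<open>u\<close> shows that the normal forms of terms
  equivalent to \<open>u\<close> are equivalent, which yields the Church-Rosser property modulo \<open>B\<close>.
\<close>

section \<open>Terms and positions\<close>

lemma Nil_in_poss [simp]: "[] \<in> poss t"
  by (cases t) auto

lemma Cons_in_poss_Fun [simp]: "i # p \<in> poss (Fun f ts) \<longleftrightarrow> i < length ts \<and> p \<in> poss (ts ! i)"
  by auto

lemma Cons_in_poss_Var [simp]: "i # p \<notin> poss (Var x)"
  by auto

declare poss.simps [simp del]

lemma poss_induct [consumes 1, case_names Nil Cons]:
  assumes "p \<in> poss t"
    and "\<And>t. P t []"
    and "\<And>f ts i p. i < length ts \<Longrightarrow> p \<in> poss (ts ! i) \<Longrightarrow> P (ts ! i) p \<Longrightarrow> P (Fun f ts) (i # p)"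
  shows "P t p"
  using assms(1)
proof (induction p arbitrary: t)
  case Nil
  show ?case by (rule assms(2))
next
  case (Cons i p)
  then show ?case by (cases t) (auto intro: assms(3))
qed

lemma poss_append: "p \<in> poss t \<Longrightarrow> p @ q \<in> poss t \<longleftrightarrow> q \<in> poss (subt_at t p)"
  by (induction rule: poss_induct) auto

lemma subt_at_append: "p \<in> poss t \<Longrightarrow> subt_at t (p @ q) = subt_at (subt_at t p) q"
  by (induction rule: poss_induct) auto

lemma replace_at_append:
  "p \<in> poss t \<Longrightarrow> replace_at t (p @ q) s = replace_at t p (replace_at (subt_at t p) q s)"
  by (induction rule: poss_induct) auto

lemma poss_replace_at [simp]: "p \<in> poss t \<Longrightarrow> p \<in> poss (replace_at t p s)"
  by (induction rule: poss_induct) auto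

lemma subt_at_replace_at [simp]: "p \<in> poss t \<Longrightarrow> subt_at (replace_at t p s) p = s"
  by (induction rule: poss_induct) auto

lemma replace_at_subt_at [simp]: "p \<in> poss t \<Longrightarrow> replace_at t p (subt_at t p) = t"
  by (induction rule: poss_induct) auto

lemma position_cases:
  obtains (below) r where "q = p @ r" | (above) r where "p = q @ r" | (parallel) "p \<parallel> q"
  by (metis parallelI prefixE)

lemma replace_at_replace_at [simp]:
  "p \<in> poss t \<Longrightarrow> replace_at (replace_at t p a) p b = replace_at t p b"
  by (induction rule: poss_induct) auto

lemma replace_at_parallel:
  assumes "p \<parallel> q" "p \<in> poss t" "q \<in> poss t"
  shows "q \<in> poss (replace_at t p a)"
    and "subt_at (replace_at t p a) q = subt_at t q"
    and "replace_at (replace_at t p a) q b = replace_at (replace_at t q b) p a"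
proof -
  obtain r i j p' q' where ij: "i \<noteq> j" and pq: "p = r @ i # p'" "q = r @ j # q'"
    using parallel_decomp[OF assms(1)] by blast
  have "q \<in> poss (replace_at t p a) \<and> subt_at (replace_at t p a) q = subt_at t q \<and>
    replace_at (replace_at t p a) q b = replace_at (replace_at t q b) p a"
    using assms(2,3) unfolding pq
  proof (induction r arbitrary: t)
    case Nil
    then show ?case using ij by (cases t) (auto simp: list_update_swap)
  next
    case (Cons k r)
    then show ?case by (cases t) auto
  qed
  then show "q \<in> poss (replace_at t p a)"
    and "subt_at (replace_at t p a) q = subt_at t q"
    and "replace_at (replace_at t p a) q b = replace_at (replace_at t q b) p a"
    by auto
qed

lemma size_nth_less_Fun: "i < length ts \<Longrightarrow> size (ts ! i) < size (Fun f ts)"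
  by (auto intro!: size_list_estimation' nth_mem le_imp_less_Suc)

lemma size_subt_at_less: "p \<in> poss t \<Longrightarrow> p \<noteq> [] \<Longrightarrow> size (subt_at t p) < size t"
proof (induction rule: poss_induct)
  case (Cons f ts i p)
  then show ?case using size_nth_less_Fun[of i ts f] by (cases "p = []") auto
qed simp

lemma subst_cong: "(\<And>x. x \<in> vars t \<Longrightarrow> \<sigma> x = \<tau> x) \<Longrightarrow> subst t \<sigma> = subst t \<tau>"
  by (induction t) auto

lemma subst_eqD: "subst t \<sigma> = subst t \<tau> \<Longrightarrow> x \<in> vars t \<Longrightarrow> \<sigma> x = \<tau> x"
  by (induction t) auto

lemma subst_subst: "subst (subst t \<sigma>) \<tau> = subst t (\<lambda>x. subst (\<sigma> x) \<tau>)"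
  by (induction t) auto

lemma subst_Var [simp]: "subst t Var = t"
  by (induction t) (auto simp: map_idI)

lemma finite_vars [simp]: "finite (vars t)"
  by (induction t) auto

lemma vars_subst: "vars (subst t \<sigma>) = (\<Union>x \<in> vars t. vars (\<sigma> x))"
  by (induction t) auto

lemma poss_subst: "p \<in> poss t \<Longrightarrow> p \<in> poss (subst t \<sigma>)"
  by (induction rule: poss_induct) auto

lemma subt_at_subst: "p \<in> poss t \<Longrightarrow> subt_at (subst t \<sigma>) p = subst (subt_at t p) \<sigma>"
  by (induction rule: poss_induct) auto

lemma subst_replace_at:
  "p \<in> poss t \<Longrightarrow> subst (replace_at t p s) \<sigma> = replace_at (subst t \<sigma>) p (subst s \<sigma>)"
  by (induction rule: poss_induct) (auto simp: map_update)

lemma poss_subst_cases: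
  assumes "p \<in> poss (subst t \<sigma>)"
  obtains (inside) "p \<in> poss t" "\<nexists>x. subt_at t p = Var x"
  | (below_variable) q r x where "p = q @ r" "q \<in> poss t" "subt_at t q = Var x" "r \<in> poss (\<sigma> x)"
  using assms
proof (induction t arbitrary: p thesis)
  case (Var x)
  then show ?case by (intro Var.prems(2)[of "[]" p x]) simp_all
next
  case (Fun f ts)
  show ?case
  proof (cases p)
    case Nil
    then show ?thesis by (intro Fun.prems(1)) simp_all
  next
    case (Cons i q)
    then have i: "i < length ts" "q \<in> poss (subst (ts ! i) \<sigma>)"
      using Fun.prems(3) by auto
    show ?thesis
    proof (rule Fun.IH[OF nth_mem[OF i(1)] _ _ i(2)])
      assume "q \<in> poss (ts ! i)" "\<nexists>x. subt_at (ts ! i) q = Var x"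
      then show ?thesis using Cons i(1) by (intro Fun.prems(1)) simp_all
    next
      fix q' r x
      assume "q = q' @ r" "q' \<in> poss (ts ! i)" "subt_at (ts ! i) q' = Var x" "r \<in> poss (\<sigma> x)"
      then show ?thesis using Cons i(1) by (intro Fun.prems(2)[of "i # q'" r x]) simp_all
    qed
  qed
qed

lemma vars_obtain_pos:
  assumes "x \<in> vars t"
  obtains p where "p \<in> poss t" "subt_at t p = Var x"
  using assms
proof (induction t arbitrary: thesis)
  case (Var y)
  then show ?case by (intro Var.prems(1)[of "[]"]) simp_all
next
  case (Fun f ts)
  then obtain i where i: "i < length ts" "x \<in> vars (ts ! i)"
    by (auto simp: in_set_conv_nth)
  then obtain p where "p \<in> poss (ts ! i)" "subt_at (ts ! i) p = Var x"
    using Fun.IH[of "ts ! i"] by auto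
  then show ?case using i by (intro Fun.prems(1)[of "i # p"]) simp_all
qed

lemma vars_subt_at: "p \<in> poss t \<Longrightarrow> vars (subt_at t p) \<subseteq> vars t"
  by (induction rule: poss_induct) (auto, metis nth_mem subsetD)

lemma replace_at_linear_var:
  assumes "p \<in> poss t" "linear t" "subt_at t p = Var x"
  shows "replace_at (subst t \<sigma>) p v = subst t (\<sigma>(x := v))"
  using assms
proof (induction rule: poss_induct)
  case (Cons f ts i p)
  have "x \<in> vars (ts ! i)"
    using vars_subt_at[OF Cons.hyps(2)] Cons.prems(2) Cons.hyps(1) by auto
  then have "x \<notin> vars (ts ! j)" if "j < length ts" "j \<noteq> i" for j
    using Cons.prems(1) Cons.hyps(1) that by auto
  then have "subst (ts ! j) \<sigma> = subst (ts ! j) (\<sigma>(x := v))" if "j < length ts" "j \<noteq> i" for j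
    using that by (intro subst_cong) auto
  then have "(map (\<lambda>t. subst t \<sigma>) ts)[i := subst (ts ! i) (\<sigma>(x := v))] =
      map (\<lambda>t. subst t (\<sigma>(x := v))) ts"
    using Cons.hyps(1) by (intro nth_equalityI) (auto simp: nth_list_update)
  then show ?case using Cons by (simp del: fun_upd_apply)
qed simp

section \<open>Unification\<close>

definition unifies :: "('v \<Rightarrow> ('f, 'v) trm) \<Rightarrow> ('f, 'v) rule list \<Rightarrow> bool" where
  "unifies \<sigma> E \<longleftrightarrow> (\<forall>(s, t) \<in> set E. subst s \<sigma> = subst t \<sigma>)"

definition is_mgu_eqs :: "('v \<Rightarrow> ('f, 'v) trm) \<Rightarrow> ('f, 'v) rule list \<Rightarrow> bool" where
  "is_mgu_eqs \<sigma> E \<longleftrightarrow> unifies \<sigma> E \<and> (\<forall>\<tau>. unifies \<tau> E \<longrightarrow> (\<exists>\<delta>. \<forall>x. \<tau> x = subst (\<sigma> x) \<delta>))"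

definition vars_eqs :: "('f, 'v) rule list \<Rightarrow> 'v set" where
  "vars_eqs E = (\<Union>(s, t) \<in> set E. vars s \<union> vars t)"

definition size_eqs :: "('f, 'v) rule list \<Rightarrow> nat" where
  "size_eqs E = (\<Sum>(s, t) \<leftarrow> E. size s + size t)"

definition subst_eqs :: "('f, 'v) rule list \<Rightarrow> ('v \<Rightarrow> ('f, 'v) trm) \<Rightarrow> ('f, 'v) rule list" where
  "subst_eqs E \<sigma> = map (\<lambda>(s, t). (subst s \<sigma>, subst t \<sigma>)) E"

lemma finite_vars_eqs [simp]: "finite (vars_eqs E)"
  by (auto simp: vars_eqs_def)

lemma unifies_Nil [simp]: "unifies \<sigma> []"
  by (simp add: unifies_def)

lemma unifies_Cons [simp]: "unifies \<sigma> ((s, t) # E) \<longleftrightarrow> subst s \<sigma> = subst t \<sigma> \<and> unifies \<sigma> E"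
  by (simp add: unifies_def)

lemma unifies_subst_eqs: "unifies \<tau> (subst_eqs E \<sigma>) \<longleftrightarrow> unifies (\<lambda>x. subst (\<sigma> x) \<tau>) E"
  by (auto simp: unifies_def subst_eqs_def subst_subst)

lemma unifies_eliminate:
  assumes "\<tau> x = subst t \<tau>"
  shows "unifies \<tau> (subst_eqs E (Var(x := t))) \<longleftrightarrow> unifies \<tau> E"
proof -
  have "(\<lambda>y. subst ((Var(x := t)) y) \<tau>) = \<tau>" using assms by auto
  then show ?thesis by (simp only: unifies_subst_eqs)
qed

lemma unifies_decompose:
  assumes "length ss = length ts"
  shows "unifies \<sigma> ((Fun f ss, Fun f ts) # E) \<longleftrightarrow> unifies \<sigma> (zip ss ts @ E)"
  using assms by (auto simp: unifies_def list_eq_iff_nth_eq set_zip)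

lemma size_le_size_subst: "x \<in> vars t \<Longrightarrow> size (\<sigma> x) \<le> size (subst t \<sigma>)"
proof (induction t)
  case (Fun f ts)
  then obtain i where i: "i < length ts" "x \<in> vars (ts ! i)" by (auto simp: in_set_conv_nth)
  then have "size (\<sigma> x) \<le> size (subst (ts ! i) \<sigma>)" using Fun.IH[of "ts ! i"] by simp
  also have "\<dots> < size (subst (Fun f ts) \<sigma>)"
    using size_nth_less_Fun[of i "map (\<lambda>t. subst t \<sigma>) ts" f] i(1) by simp
  finally show ?case by simp
qed simp

lemma occurs_check:
  assumes "\<sigma> x = subst t \<sigma>" "t \<noteq> Var x"
  shows "x \<notin> vars t"
proof (cases t)
  case (Fun f ts)
  have "x \<notin> vars (ts ! i)" if "i < length ts" for i
    using size_le_size_subst[of x "ts ! i" \<sigma>] that assms(1) Fun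
      size_nth_less_Fun[of i "map (\<lambda>t. subst t \<sigma>) ts" f] by auto
  then show ?thesis using Fun by (auto simp: in_set_conv_nth)
qed (use assms(2) in auto)

lemma unifiable_cases:
  assumes "subst s \<tau> = subst t \<tau>"
  obtains (trivial) x where "s = Var x" "t = Var x"
  | (eliminate_left) x where "s = Var x" "x \<notin> vars t"
  | (eliminate_right) x where "t = Var x" "x \<notin> vars s"
  | (decompose) f ss ts where "s = Fun f ss" "t = Fun f ts" "length ss = length ts"
proof (cases s)
  case (Var x)
  then show thesis using that(1,2) occurs_check[of \<tau> x t] assms by auto
next
  case (Fun f ss)
  then show thesis
    using that(3,4) occurs_check[of \<tau> _ s] assms
    by (cases t) (auto dest: map_eq_imp_length_eq simp del: vars.simps)
qed

lemma vars_eqs_eliminate: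
  assumes "x \<notin> vars t"
  shows "vars_eqs (subst_eqs E (Var(x := t))) \<subset> vars_eqs ((Var x, t) # E)"
proof
  show "vars_eqs (subst_eqs E (Var(x := t))) \<subseteq> vars_eqs ((Var x, t) # E)"
    by (fastforce simp: vars_eqs_def subst_eqs_def vars_subst split: if_splits)
  have "x \<notin> vars_eqs (subst_eqs E (Var(x := t)))"
    using assms by (auto simp: vars_eqs_def subst_eqs_def vars_subst split: if_splits)
  then show "vars_eqs (subst_eqs E (Var(x := t))) \<noteq> vars_eqs ((Var x, t) # E)"
    by (auto simp: vars_eqs_def)
qed

lemma vars_eqs_decompose:
  assumes "length ss = length ts"
  shows "vars_eqs ((Fun f ss, Fun f ts) # E) = vars_eqs (zip ss ts @ E)"
proof -
  have "vars_eqs (zip ss ts) = vars (Fun f ss) \<union> vars (Fun f ts)"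
    using assms by (induction ss ts rule: list_induct2) (auto simp: vars_eqs_def)
  then show ?thesis by (simp add: vars_eqs_def)
qed

lemma size_eqs_decompose:
  assumes "length ss = length ts"
  shows "size_eqs (zip ss ts @ E) < size_eqs ((Fun f ss, Fun f ts) # E)"
proof -
  have "size_eqs (zip ss ts) \<le> size_list size ss + size_list size ts"
    using assms by (induction ss ts rule: list_induct2) (auto simp: size_eqs_def)
  then show ?thesis by (simp add: size_eqs_def)
qed

definition simpler_eqs :: "('f, 'v) rule list rel" where
  "simpler_eqs = measures [\<lambda>E. card (vars_eqs E), size_eqs]"

lemma wf_simpler_eqs: "wf simpler_eqs"
  by (simp add: simpler_eqs_def)

lemma simpler_eqsI: "vars_eqs E \<subseteq> vars_eqs E' \<Longrightarrow> size_eqs E < size_eqs E' \<Longrightarrow> (E, E') \<in> simpler_eqs"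
  using card_mono[of "vars_eqs E'" "vars_eqs E"] by (auto simp: simpler_eqs_def)

lemma simpler_eqs_trivial: "(E, (Var x, Var x) # E) \<in> simpler_eqs"
  by (rule simpler_eqsI) (auto simp: vars_eqs_def size_eqs_def)

lemma simpler_eqs_decompose:
  assumes "length ss = length ts"
  shows "(zip ss ts @ E, (Fun f ss, Fun f ts) # E) \<in> simpler_eqs"
  using vars_eqs_decompose[OF assms] size_eqs_decompose[OF assms] by (intro simpler_eqsI) blast+

lemma simpler_eqs_eliminate:
  assumes "x \<notin> vars t"
  shows "(subst_eqs E (Var(x := t)), (Var x, t) # E) \<in> simpler_eqs"
    and "(subst_eqs E (Var(x := t)), (t, Var x) # E) \<in> simpler_eqs"
proof -
  have "vars_eqs ((t, Var x) # E) = vars_eqs ((Var x, t) # E)" by (auto simp: vars_eqs_def)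
  then show "(subst_eqs E (Var(x := t)), (Var x, t) # E) \<in> simpler_eqs"
    "(subst_eqs E (Var(x := t)), (t, Var x) # E) \<in> simpler_eqs"
    using psubset_card_mono[OF _ vars_eqs_eliminate[OF assms, of E]] by (simp_all add: simpler_eqs_def)
qed

lemma unifiable_induct
  [consumes 1, case_names Nil trivial decompose eliminate_left eliminate_right]:
  fixes E :: "('f, 'v) rule list"
  assumes "unifies \<tau> E"
    and "P []"
    and "\<And>x E. P E \<Longrightarrow> P ((Var x, Var x) # E)"
    and "\<And>f ss ts E. length ss = length ts \<Longrightarrow> P (zip ss ts @ E) \<Longrightarrow>
      P ((Fun f ss, Fun f ts) # E)"
    and "\<And>x t E. x \<notin> vars t \<Longrightarrow> P (subst_eqs E (Var(x := t))) \<Longrightarrow> P ((Var x, t) # E)"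
    and "\<And>x t E. x \<notin> vars t \<Longrightarrow> P (subst_eqs E (Var(x := t))) \<Longrightarrow> P ((t, Var x) # E)"
  shows "P E"
  using assms(1)
proof (induction E rule: wf_induct_rule[OF wf_simpler_eqs, case_names less])
  case (less E)
  show ?case
  proof (cases E)
    case Nil
    then show ?thesis using assms(2) by simp
  next
    case (Cons e E')
    obtain s t where E: "E = (s, t) # E'" using Cons by (cases e) simp
    have unif: "subst s \<tau> = subst t \<tau>" "unifies \<tau> E'" using less.prems by (simp_all add: E)
    from unif(1) show ?thesis
    proof (cases rule: unifiable_cases)
      case (trivial x)
      then have "P E'" using less.IH[OF _ unif(2)] simpler_eqs_trivial[of E' x] E by simp
      then show ?thesis unfolding E trivial by (rule assms(3))
    next
      case (eliminate_left x)
      then have "unifies \<tau> (subst_eqs E' (Var(x := t)))"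
        using unif by (intro unifies_eliminate[THEN iffD2]) simp_all
      then have "P (subst_eqs E' (Var(x := t)))"
        by (rule less.IH[rotated])
          (simp only: E eliminate_left(1) simpler_eqs_eliminate(1)[OF eliminate_left(2)])
      then show ?thesis unfolding E eliminate_left(1) by (rule assms(5)[OF eliminate_left(2)])
    next
      case (eliminate_right x)
      then have "unifies \<tau> (subst_eqs E' (Var(x := s)))"
        using unif by (intro unifies_eliminate[THEN iffD2]) simp_all
      then have "P (subst_eqs E' (Var(x := s)))"
        by (rule less.IH[rotated])
          (simp only: E eliminate_right(1) simpler_eqs_eliminate(2)[OF eliminate_right(2)])
      then show ?thesis unfolding E eliminate_right(1) by (rule assms(6)[OF eliminate_right(2)])
    next
      case (decompose f ss ts)
      have "unifies \<tau> (zip ss ts @ E')"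
        using less.prems unifies_decompose[OF decompose(3)] unfolding E decompose(1,2) by blast
      then have "P (zip ss ts @ E')"
        by (rule less.IH[rotated])
          (simp only: E decompose(1,2) simpler_eqs_decompose[OF decompose(3)])
      then show ?thesis unfolding E decompose(1,2) by (rule assms(4)[OF decompose(3)])
    qed
  qed
qed

lemma is_mgu_eqs_cong: "(\<And>\<tau>. unifies \<tau> E \<longleftrightarrow> unifies \<tau> E') \<Longrightarrow> is_mgu_eqs \<sigma> E \<longleftrightarrow> is_mgu_eqs \<sigma> E'"
  by (simp add: is_mgu_eqs_def)

lemma is_mgu_eqs_eliminate:
  assumes x: "x \<notin> vars t" and \<sigma>: "is_mgu_eqs \<sigma> (subst_eqs E (Var(x := t)))"
  shows "is_mgu_eqs (\<lambda>y. subst ((Var(x := t)) y) \<sigma>) ((Var x, t) # E)"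
  unfolding is_mgu_eqs_def
proof (intro conjI allI impI)
  let ?\<rho> = "\<lambda>y. subst ((Var(x := t)) y) \<sigma>"
  have "subst t ?\<rho> = subst t \<sigma>" using x by (intro subst_cong) auto
  then show "unifies ?\<rho> ((Var x, t) # E)"
    using \<sigma> by (simp add: is_mgu_eqs_def unifies_subst_eqs)
  fix \<tau>
  assume \<tau>: "unifies \<tau> ((Var x, t) # E)"
  then have "unifies \<tau> (subst_eqs E (Var(x := t)))" by (simp add: unifies_eliminate)
  then obtain \<delta> where \<delta>: "\<And>y. \<tau> y = subst (\<sigma> y) \<delta>"
    using \<sigma> by (auto simp: is_mgu_eqs_def)
  then have "\<tau> y = subst (?\<rho> y) \<delta>" for y
    using \<tau> by (auto simp: subst_subst \<delta>[symmetric])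
  then show "\<exists>\<delta>. \<forall>y. \<tau> y = subst (?\<rho> y) \<delta>" by blast
qed

lemma is_mgu_eqs_exists: "unifies \<tau> E \<Longrightarrow> \<exists>\<sigma>. is_mgu_eqs \<sigma> E"
proof (induction rule: unifiable_induct)
  case Nil
  have "is_mgu_eqs Var []" by (simp add: is_mgu_eqs_def) metis
  then show ?case by blast
next
  case (trivial x E)
  have "is_mgu_eqs \<sigma> ((Var x, Var x) # E) \<longleftrightarrow> is_mgu_eqs \<sigma> E" for \<sigma>
    by (rule is_mgu_eqs_cong) simp
  then show ?case using trivial by simp
next
  case (decompose f ss ts E)
  have "is_mgu_eqs \<sigma> ((Fun f ss, Fun f ts) # E) \<longleftrightarrow> is_mgu_eqs \<sigma> (zip ss ts @ E)" for \<sigma>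
    by (rule is_mgu_eqs_cong) (simp only: unifies_decompose[OF decompose(1)])
  then show ?case using decompose by simp
next
  case (eliminate_left x t E)
  then show ?case by (auto dest: is_mgu_eqs_eliminate)
next
  case (eliminate_right x t E)
  have "is_mgu_eqs \<sigma> ((t, Var x) # E) \<longleftrightarrow> is_mgu_eqs \<sigma> ((Var x, t) # E)" for \<sigma>
    by (rule is_mgu_eqs_cong) auto
  then show ?case using eliminate_right by (auto dest: is_mgu_eqs_eliminate)
qed

lemma is_mgu_exists:
  assumes "subst s \<tau> = subst t \<tau>"
  shows "\<exists>\<sigma>. is_mgu \<sigma> s t"
  using is_mgu_eqs_exists[of \<tau> "[(s, t)]"] assms by (simp add: is_mgu_eqs_def is_mgu_def)

section \<open>Rewrite relations\<close>

definition rewrite_closed :: "('f, 'v) trm rel \<Rightarrow> bool" where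
  "rewrite_closed S \<longleftrightarrow> (\<forall>s t u p \<sigma>. (s, t) \<in> S \<longrightarrow> p \<in> poss u \<longrightarrow>
     (replace_at u p (subst s \<sigma>), replace_at u p (subst t \<sigma>)) \<in> S)"

lemma rewrite_closedI:
  "(\<And>s t u p \<sigma>. (s, t) \<in> S \<Longrightarrow> p \<in> poss u \<Longrightarrow>
     (replace_at u p (subst s \<sigma>), replace_at u p (subst t \<sigma>)) \<in> S) \<Longrightarrow> rewrite_closed S"
  by (simp add: rewrite_closed_def)

lemma rewrite_closedD:
  "rewrite_closed S \<Longrightarrow> (s, t) \<in> S \<Longrightarrow> p \<in> poss u \<Longrightarrow>
    (replace_at u p (subst s \<sigma>), replace_at u p (subst t \<sigma>)) \<in> S"
  by (simp add: rewrite_closed_def)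

lemma rewrite_closed_ctxt:
  "rewrite_closed S \<Longrightarrow> (s, t) \<in> S \<Longrightarrow> p \<in> poss u \<Longrightarrow> (replace_at u p s, replace_at u p t) \<in> S"
  using rewrite_closedD[of S s t p u Var] by simp

lemma rewrite_closed_subst: "rewrite_closed S \<Longrightarrow> (s, t) \<in> S \<Longrightarrow> (subst s \<sigma>, subst t \<sigma>) \<in> S"
  using rewrite_closedD[of S s t "[]" s \<sigma>] by simp

lemma rewrite_closed_Un: "rewrite_closed S \<Longrightarrow> rewrite_closed T \<Longrightarrow> rewrite_closed (S \<union> T)"
  by (rule rewrite_closedI) (metis Un_iff rewrite_closedD)

lemma rewrite_closed_Int: "rewrite_closed S \<Longrightarrow> rewrite_closed T \<Longrightarrow> rewrite_closed (S \<inter> T)"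
  by (rule rewrite_closedI) (metis Int_iff rewrite_closedD)

lemma rewrite_closed_Union: "(\<And>S. S \<in> \<S> \<Longrightarrow> rewrite_closed S) \<Longrightarrow> rewrite_closed (\<Union>\<S>)"
  by (rule rewrite_closedI) (blast dest: rewrite_closedD)

lemma rewrite_closed_converse: "rewrite_closed S \<Longrightarrow> rewrite_closed (S\<inverse>)"
  by (rule rewrite_closedI) (metis converse_iff rewrite_closedD)

lemma rewrite_closed_relcomp:
  "rewrite_closed S \<Longrightarrow> rewrite_closed T \<Longrightarrow> rewrite_closed (S O T)"
  by (rule rewrite_closedI) (blast dest: rewrite_closedD)

lemma rewrite_closed_rtrancl:
  assumes "rewrite_closed S"
  shows "rewrite_closed (S\<^sup>*)"
proof (rule rewrite_closedI)
  fix s t u :: "('a, 'b) trm" and p \<sigma>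
  assume "(s, t) \<in> S\<^sup>*" and p: "p \<in> poss u"
  then show "(replace_at u p (subst s \<sigma>), replace_at u p (subst t \<sigma>)) \<in> S\<^sup>*"
  proof (induction rule: rtrancl_induct)
    case (step y z)
    then show ?case using rewrite_closedD[OF assms step(2) p, of \<sigma>] by (simp add: rtrancl_into_rtrancl)
  qed simp
qed

lemma rewrite_closed_rtrancl_Fun:
  assumes S: "rewrite_closed S" and "list_all2 (\<lambda>t s. (t, s) \<in> S\<^sup>*) ts ss"
  shows "(Fun f (us @ ts), Fun f (us @ ss)) \<in> S\<^sup>*"
  using assms(2)
proof (induction arbitrary: us rule: list_all2_induct)
  case (Cons t ts s ss)
  have "(Fun f (us @ t # ts), Fun f (us @ s # ts)) \<in> S\<^sup>*"
    using rewrite_closed_ctxt[OF rewrite_closed_rtrancl[OF S] Cons(1),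
        of "[length us]" "Fun f (us @ t # ts)"] by simp
  also have "(Fun f (us @ s # ts), Fun f (us @ s # ss)) \<in> S\<^sup>*"
    using Cons.IH[of "us @ [s]"] by simp
  finally show ?case .
qed simp

lemma rewrite_closed_rtrancl_subst:
  assumes "rewrite_closed S" "\<And>x. x \<in> vars t \<Longrightarrow> (\<sigma> x, \<tau> x) \<in> S\<^sup>*"
  shows "(subst t \<sigma>, subst t \<tau>) \<in> S\<^sup>*"
  using assms(2)
proof (induction t)
  case (Fun f ts)
  then have "(subst t \<sigma>, subst t \<tau>) \<in> S\<^sup>*" if "t \<in> set ts" for t
    using that by auto
  then have "list_all2 (\<lambda>t s. (t, s) \<in> S\<^sup>*) (map (\<lambda>t. subst t \<sigma>) ts) (map (\<lambda>t. subst t \<tau>) ts)"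
    by (simp add: list_all2_conv_all_nth)
  then show ?case using rewrite_closed_rtrancl_Fun[OF assms(1), where us = "[]"] by simp
qed simp

lemma rewrite_closed_rtrancl_replace_var:
  assumes S: "rewrite_closed S" and v: "(\<sigma> x, v) \<in> S"
    and "p \<in> poss t" "subt_at t p = Var x"
  shows "(replace_at (subst t \<sigma>) p v, subst t (\<sigma>(x := v))) \<in> S\<^sup>*"
  using assms(3,4)
proof (induction rule: poss_induct)
  case (Cons f ts i p)
  have "(subst (ts ! j) \<sigma>, subst (ts ! j) (\<sigma>(x := v))) \<in> S\<^sup>*" for j
    using v by (intro rewrite_closed_rtrancl_subst[OF S]) auto
  then show ?case
    using Cons rewrite_closed_rtrancl_Fun[OF S, where us = "[]"]
    by (auto simp: list_all2_conv_all_nth nth_list_update simp del: fun_upd_apply)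
qed simp

lemma rstepI:
  "(l, r) \<in> R \<Longrightarrow> p \<in> poss u \<Longrightarrow> (replace_at u p (subst l \<sigma>), replace_at u p (subst r \<sigma>)) \<in> rstep R"
  unfolding rstep_def by (rule CollectI, rule case_prodI, rule exI[of _ l], rule exI[of _ r],
      rule exI[of _ p], rule exI[of _ \<sigma>]) simp

lemma rstepE:
  assumes "(s, t) \<in> rstep R"
  obtains l r p u \<sigma> where "(l, r) \<in> R" "p \<in> poss u"
    "s = replace_at u p (subst l \<sigma>)" "t = replace_at u p (subst r \<sigma>)"
proof -
  obtain l r p \<sigma> where "(l, r) \<in> R" "p \<in> poss s"
    "subt_at s p = subst l \<sigma>" "t = replace_at s p (subst r \<sigma>)"
    using assms unfolding rstep_def by blast
  then show thesis using that[of l r p s \<sigma>] replace_at_subt_at[of p s] by simp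
qed

lemma rewrite_closed_rstep: "rewrite_closed (rstep R)"
proof (rule rewrite_closedI)
  fix s t v :: "('a, 'b) trm" and q \<tau>
  assume "(s, t) \<in> rstep R" and q: "q \<in> poss v"
  then obtain l r p u \<sigma> where lr: "(l, r) \<in> R" and p: "p \<in> poss u"
    and st: "s = replace_at u p (subst l \<sigma>)" "t = replace_at u p (subst r \<sigma>)"
    by (blast elim: rstepE)
  let ?v = "replace_at v q (subst u \<tau>)"
  have qp: "q @ p \<in> poss ?v" using q p by (simp add: poss_append poss_subst)
  have merge: "replace_at v q (subst (replace_at u p (subst a \<sigma>)) \<tau>) =
      replace_at ?v (q @ p) (subst a (\<lambda>x. subst (\<sigma> x) \<tau>))" for a
    using q p by (simp add: replace_at_append subst_replace_at subst_subst)
  show "(replace_at v q (subst s \<tau>), replace_at v q (subst t \<tau>)) \<in> rstep R"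
    unfolding st merge using lr qp by (rule rstepI)
qed

lemma subset_rstep: "R \<subseteq> rstep R"
  using rstepI[of _ _ R "[]" _ Var] by auto

lemma rstep_least: "rewrite_closed S \<Longrightarrow> R \<subseteq> S \<Longrightarrow> rstep R \<subseteq> S"
  by (auto elim!: rstepE intro!: rewrite_closedD)

lemma rstep_Un: "rstep (R \<union> S) = rstep R \<union> rstep S"
  unfolding rstep_def by blast

lemma rstep_converse: "rstep (R\<inverse>) = (rstep R)\<inverse>"
proof -
  have "rstep (S\<inverse>) \<subseteq> (rstep S)\<inverse>" for S :: "('a, 'b) rule set"
    using subset_rstep[of S] by (intro rstep_least rewrite_closed_converse rewrite_closed_rstep) auto
  from this[of R] this[of "R\<inverse>"] show ?thesis by auto
qed

lemma NF_subst: "NF R (subst t \<sigma>) \<Longrightarrow> NF R t"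
  using rewrite_closed_subst[OF rewrite_closed_rstep] unfolding NF_def by blast

lemma rstep_Bpm: "rstep (Bpm B) = sstep B"
  by (simp add: Bpm_def sstep_def rstep_Un rstep_converse)

lemma sstep_Un: "sstep (R \<union> S) = sstep R \<union> sstep S"
  by (auto simp: sstep_def rstep_Un)

lemma sym_sstep: "sym (sstep R)"
  by (auto simp: sstep_def sym_def)

lemma sstep_least: "rewrite_closed S \<Longrightarrow> sym S \<Longrightarrow> R \<subseteq> S \<Longrightarrow> sstep R \<subseteq> S"
  using rstep_least[of S R] by (auto simp: sstep_def dest: symD)

lemma rewrite_closed_sstep: "rewrite_closed (sstep R)"
  by (simp add: sstep_def rewrite_closed_Un rewrite_closed_converse rewrite_closed_rstep)

lemma rewrite_closed_conv: "rewrite_closed (conv R)"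
  by (simp add: conv_def rewrite_closed_rtrancl rewrite_closed_sstep)

lemma sym_conv: "sym (conv R)"
  by (simp add: conv_def sym_rtrancl sym_sstep)

lemma conv_sym: "(s, t) \<in> conv R \<Longrightarrow> (t, s) \<in> conv R"
  using sym_conv by (rule symD)

lemma conv_trans: "(s, t) \<in> conv R \<Longrightarrow> (t, u) \<in> conv R \<Longrightarrow> (s, u) \<in> conv R"
  by (simp add: conv_def)

lemma subset_conv: "R \<subseteq> conv R"
  using subset_rstep[of R] by (auto simp: conv_def sstep_def)

lemma sstep_subset_conv: "R \<subseteq> conv S \<Longrightarrow> sstep R \<subseteq> conv S"
  by (rule sstep_least[OF rewrite_closed_conv sym_conv])

lemma rstep_subset_conv: "R \<subseteq> conv S \<Longrightarrow> rstep R \<subseteq> conv S"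
  by (rule rstep_least[OF rewrite_closed_conv])

lemma conv_least: "R \<subseteq> conv S \<Longrightarrow> conv R \<subseteq> conv S"
  using rtrancl_subset_rtrancl[of "sstep R" "sstep S"] sstep_subset_conv[of R S] by (simp add: conv_def)

lemma rewrite_closed_simB: "rewrite_closed (simB B)"
  by (simp add: simB_def rewrite_closed_conv)

lemma simB_refl [simp]: "(s, s) \<in> simB B"
  by (simp add: simB_def conv_def)

lemma simB_sym: "(s, t) \<in> simB B \<Longrightarrow> (t, s) \<in> simB B"
  unfolding simB_def by (rule conv_sym)

lemma sstep_subset_simB: "sstep B \<subseteq> simB B"
  by (auto simp: simB_def conv_def)

lemma Bpm_subset_simB: "Bpm B \<subseteq> simB B"
  using subset_rstep[of "Bpm B"] sstep_subset_simB[of B] by (simp add: rstep_Bpm)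

lemma rstep_Bpm_simB: "(s, t) \<in> rstep (Bpm B) \<Longrightarrow> (s, t) \<in> simB B"
  using sstep_subset_simB by (auto simp: rstep_Bpm)

lemma rsteps_Bpm_simB: "(s, t) \<in> (rstep (Bpm B))\<^sup>* \<Longrightarrow> (s, t) \<in> simB B"
  by (simp add: rstep_Bpm simB_def conv_def)

lemma rel_mod_subset_conv:
  assumes "R \<subseteq> conv S" "B \<subseteq> conv S"
  shows "rel_mod R B \<subseteq> conv S"
  using rstep_subset_conv[OF assms(1)] conv_least[OF assms(2)] conv_trans
  unfolding rel_mod_def simB_def by blast

lemma join_mod_iff:
  "(s, t) \<in> join_mod R B \<longleftrightarrow>
    (\<exists>s' t'. (s, s') \<in> (rstep R)\<^sup>* \<and> (s', t') \<in> simB B \<and> (t, t') \<in> (rstep R)\<^sup>*)"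
  unfolding join_mod_def rtrancl_converse by blast

lemma join_modI:
  "(s, s') \<in> (rstep R)\<^sup>* \<Longrightarrow> (s', t') \<in> simB B \<Longrightarrow> (t, t') \<in> (rstep R)\<^sup>* \<Longrightarrow> (s, t) \<in> join_mod R B"
  unfolding join_mod_iff by blast

lemma join_mod_sym: "(s, t) \<in> join_mod R B \<Longrightarrow> (t, s) \<in> join_mod R B"
  unfolding join_mod_iff using simB_sym by blast

lemma rewrite_closed_join_mod: "rewrite_closed (join_mod R B)"
  by (simp add: join_mod_def rewrite_closed_relcomp rewrite_closed_simB rewrite_closed_rstep
      rewrite_closed_rtrancl rewrite_closed_converse)

definition rewrite_core :: "('f, 'v) trm rel \<Rightarrow> ('f, 'v) trm rel" where
  "rewrite_core S = \<Union>{T. rewrite_closed T \<and> T \<subseteq> S}"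

lemma rewrite_closed_core: "rewrite_closed (rewrite_core S)"
  unfolding rewrite_core_def by (rule rewrite_closed_Union) simp

lemma rewrite_core_subset: "rewrite_core S \<subseteq> S"
  unfolding rewrite_core_def by blast

lemma rewrite_core_greatest: "rewrite_closed T \<Longrightarrow> T \<subseteq> S \<Longrightarrow> T \<subseteq> rewrite_core S"
  unfolding rewrite_core_def by blast

section \<open>Rewriting at a position\<close>

definition rstep_at :: "('f, 'v) rule set \<Rightarrow> nat list \<Rightarrow> ('f, 'v) trm rel" where
  "rstep_at R p = {(s, t). \<exists>l r \<sigma>. (l, r) \<in> R \<and> p \<in> poss s \<and> subt_at s p = subst l \<sigma>
                  \<and> t = replace_at s p (subst r \<sigma>)}"

lemma rstep_atE:
  assumes "(s, t) \<in> rstep_at R p"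
  obtains l r \<sigma> where "(l, r) \<in> R" "p \<in> poss s"
    "subt_at s p = subst l \<sigma>" "t = replace_at s p (subst r \<sigma>)"
  using assms unfolding rstep_at_def by blast

lemma rstep_iff_rstep_at: "(s, t) \<in> rstep R \<longleftrightarrow> (\<exists>p. (s, t) \<in> rstep_at R p)"
  unfolding rstep_def rstep_at_def by blast

lemma rstep_at_subset_rstep: "rstep_at R p \<subseteq> rstep R"
  by (auto simp: rstep_iff_rstep_at)

lemma rstep_at_Bpm_simB: "(s, t) \<in> rstep_at (Bpm B) p \<Longrightarrow> (s, t) \<in> simB B"
  using rstep_at_subset_rstep rstep_Bpm_simB by blast

lemma rstep_at_append_iff:
  assumes "p \<in> poss s"
  shows "(s, t) \<in> rstep_at R (p @ q) \<longleftrightarrow>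
    (\<exists>t'. (subt_at s p, t') \<in> rstep_at R q \<and> t = replace_at s p t')"
  using assms by (auto simp: rstep_at_def poss_append subt_at_append replace_at_append)

lemma rstep_at_iff_root:
  "p \<in> poss s \<Longrightarrow> (s, t) \<in> rstep_at R p \<longleftrightarrow>
    (\<exists>t'. (subt_at s p, t') \<in> rstep_at R [] \<and> t = replace_at s p t')"
  using rstep_at_append_iff[of p s t R "[]"] by simp

lemma rstep_at_not_NF:
  assumes "(s, t) \<in> rstep_at R p"
  shows "\<not> NF R (subt_at s p)"
proof -
  have "p \<in> poss s" using assms by (rule rstep_atE)
  then show ?thesis
    using assms rstep_at_iff_root[of p s t R] by (auto simp: NF_def rstep_iff_rstep_at)
qed

lemma parallel_rstep_at_commute:
  assumes "(u, s) \<in> rstep_at R p" "(u, t) \<in> rstep_at S q" "p \<parallel> q"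
  obtains w where "(s, w) \<in> rstep_at S q" "(t, w) \<in> rstep_at R p"
proof -
  obtain a where p: "p \<in> poss u" and a: "(subt_at u p, a) \<in> rstep_at R []"
    and s: "s = replace_at u p a"
    using assms(1) rstep_at_iff_root[of p u s R] by (auto elim: rstep_atE)
  obtain b where q: "q \<in> poss u" and b: "(subt_at u q, b) \<in> rstep_at S []"
    and t: "t = replace_at u q b"
    using assms(2) rstep_at_iff_root[of q u t S] by (auto elim: rstep_atE)
  have qp: "q \<parallel> p" using assms(3) by (simp add: parallel_commute)
  have "(s, replace_at s q b) \<in> rstep_at S q"
    using b replace_at_parallel[OF assms(3) p q] rstep_at_iff_root[of q s] by (auto simp: s)
  moreover have "(t, replace_at t p a) \<in> rstep_at R p"
    using a replace_at_parallel[OF qp q p] rstep_at_iff_root[of p t] by (auto simp: t)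
  moreover have "replace_at s q b = replace_at t p a"
    unfolding s t by (rule replace_at_parallel(3)[OF assms(3) p q])
  ultimately show thesis using that by simp
qed

definition prime_at :: "('f, 'v) rule set \<Rightarrow> ('f, 'v) trm \<Rightarrow> bool" where
  "prime_at R t \<longleftrightarrow> (\<forall>q \<in> poss t. q \<noteq> [] \<longrightarrow> NF R (subt_at t q))"

lemma prime_at_subst: "prime_at R (subst t \<sigma>) \<Longrightarrow> prime_at R t"
  unfolding prime_at_def by (metis NF_subst poss_subst subt_at_subst)

lemma innermost_redex:
  assumes "\<not> NF R t"
  obtains p s where "(t, s) \<in> rstep_at R p" "prime_at R (subt_at t p)"
  using assms
proof (induction t arbitrary: thesis rule: measure_induct_rule[of size])
  case (less t)
  obtain p s where s: "(t, s) \<in> rstep_at R p"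
    using less.prems(2) by (auto simp: NF_def rstep_iff_rstep_at)
  then have p: "p \<in> poss t" by (rule rstep_atE)
  show ?case
  proof (cases "prime_at R t")
    case True
    then have "p = []" using rstep_at_not_NF[OF s] p by (auto simp: prime_at_def)
    then show ?thesis using less.prems(1)[OF s] True by simp
  next
    case False
    then obtain q where q: "q \<in> poss t" "q \<noteq> []" "\<not> NF R (subt_at t q)"
      by (auto simp: prime_at_def)
    obtain p' s' where "(subt_at t q, s') \<in> rstep_at R p'" "prime_at R (subt_at (subt_at t q) p')"
      using less.IH[OF size_subt_at_less[OF q(1,2)] _ q(3)] by blast
    then show ?thesis
      using less.prems(1)[of "replace_at t q s'" "q @ p'"] q(1)
      by (auto simp: rstep_at_append_iff subt_at_append)
  qed
qed

lemma NF_prime_at: "NF R t \<Longrightarrow> prime_at R t"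
  unfolding prime_at_def NF_def
  by (metis replace_at_subt_at rewrite_closed_ctxt rewrite_closed_rstep)

lemma innermost_redex_below:
  assumes "p \<in> poss u" "\<not> NF R (subt_at u p)"
  obtains q v where "(u, v) \<in> rstep_at R (p @ q)" "prime_at R (subt_at u (p @ q))"
proof -
  obtain q s where "(subt_at u p, s) \<in> rstep_at R q" "prime_at R (subt_at (subt_at u p) q)"
    using innermost_redex[OF assms(2)] .
  then show thesis
    using that[of "replace_at u p s" q] assms(1) by (auto simp: rstep_at_append_iff subt_at_append)
qed

section \<open>Critical pairs\<close>

lemma renaming_apart:
  assumes "infinite (UNIV :: 'v set)" "finite (A :: 'v set)" "finite C"
  obtains \<pi> :: "'v \<Rightarrow> 'v" where "bij \<pi>" "\<pi> ` A \<inter> C = {}"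
  using assms(2)
proof (induction A arbitrary: thesis rule: finite_induct)
  case empty
  show ?case by (rule empty.prems[OF bij_id]) simp
next
  case (insert a A)
  obtain \<pi> where \<pi>: "bij \<pi>" "\<pi> ` A \<inter> C = {}" using insert.IH by blast
  have "finite (C \<union> \<pi> ` A)" using assms(3) insert.hyps(1) by simp
  then obtain z where z: "z \<notin> C \<union> \<pi> ` A" using ex_new_if_finite[OF assms(1)] by blast
  have a: "\<pi> a \<notin> \<pi> ` A" using bij_is_inj[OF \<pi>(1)] insert.hyps(2) by (simp add: inj_image_mem_iff)
  show ?case
  proof (rule insert.prems[of "transpose (\<pi> a) z \<circ> \<pi>"])
    show "bij (transpose (\<pi> a) z \<circ> \<pi>)" using \<pi>(1) by (simp add: bij_comp)
    have "transpose (\<pi> a) z (\<pi> x) = \<pi> x" if "x \<in> A" for x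
      using a z imageI[OF that, of \<pi>] by (intro transpose_apply_other) auto
    then show "(transpose (\<pi> a) z \<circ> \<pi>) ` insert a A \<inter> C = {}" using \<pi>(2) z by auto
  qed
qed

lemma variant_refl: "variant \<rho> \<rho>"
  unfolding variant_def by (intro exI[of _ id]) (simp add: comp_def)

lemma variant_trans:
  assumes "variant \<rho>1 \<rho>2" "variant \<rho>2 \<rho>3"
  shows "variant \<rho>1 \<rho>3"
proof -
  obtain \<pi>1 \<pi>2 where "bij \<pi>1" "bij \<pi>2"
    "fst \<rho>2 = subst (fst \<rho>1) (Var \<circ> \<pi>1)" "snd \<rho>2 = subst (snd \<rho>1) (Var \<circ> \<pi>1)"
    "fst \<rho>3 = subst (fst \<rho>2) (Var \<circ> \<pi>2)" "snd \<rho>3 = subst (snd \<rho>2) (Var \<circ> \<pi>2)"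
    using assms unfolding variant_def by blast
  then show ?thesis unfolding variant_def
    by (intro exI[of _ "\<pi>2 \<circ> \<pi>1"]) (auto simp: subst_subst bij_comp intro!: subst_cong)
qed

lemma variant_rewrite_closed:
  assumes "rewrite_closed S" "variant \<rho> \<rho>'" "\<rho> \<in> S"
  shows "\<rho>' \<in> S"
proof -
  obtain \<pi> where "\<rho>' = (subst (fst \<rho>) (Var \<circ> \<pi>), subst (snd \<rho>) (Var \<circ> \<pi>))"
    using assms(2) unfolding variant_def by (metis prod.collapse)
  then show ?thesis using rewrite_closed_subst[OF assms(1), of "fst \<rho>" "snd \<rho>"] assms(3) by simp
qed

lemma variant_same_reduct:
  assumes "variant (l, r) (l', r')" "vars r \<subseteq> vars l" "subst l \<sigma> = subst l' \<sigma>'"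
  shows "subst r \<sigma> = subst r' \<sigma>'"
proof -
  obtain \<pi> where \<pi>: "l' = subst l (Var \<circ> \<pi>)" "r' = subst r (Var \<circ> \<pi>)"
    using assms(1) unfolding variant_def by auto
  have "subst l \<sigma> = subst l (\<lambda>x. \<sigma>' (\<pi> x))" using assms(3) by (simp add: \<pi>(1) subst_subst)
  note l = subst_eqD[OF this]
  have "\<sigma> x = \<sigma>' (\<pi> x)" if "x \<in> vars r" for x
    using that assms(2) by (intro l) auto
  then have "subst r \<sigma> = subst r (\<lambda>x. \<sigma>' (\<pi> x))" by (rule subst_cong)
  then show ?thesis by (simp add: \<pi>(2) subst_subst)
qed

lemma disjoint_variant:
  fixes l r :: "('f, 'v) trm"
  assumes "infinite (UNIV :: 'v set)" "finite C"
  obtains l' r' \<tau> where "variant (l, r) (l', r')" "rule_vars (l', r') \<inter> C = {}"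
    "subst l' \<tau> = subst l \<sigma>" "subst r' \<tau> = subst r \<sigma>" "\<And>x. x \<in> C \<Longrightarrow> \<tau> x = \<sigma>' x"
proof -
  have "finite (rule_vars (l, r))" by (simp add: rule_vars_def)
  then obtain \<pi> where \<pi>: "bij \<pi>" "\<pi> ` rule_vars (l, r) \<inter> C = {}"
    using renaming_apart[OF assms(1) _ assms(2)] by blast
  define \<tau> where "\<tau> x = (if x \<in> C then \<sigma>' x else \<sigma> (inv \<pi> x))" for x
  show thesis
  proof (rule that[of "subst l (Var \<circ> \<pi>)" "subst r (Var \<circ> \<pi>)" \<tau>])
    show "variant (l, r) (subst l (Var \<circ> \<pi>), subst r (Var \<circ> \<pi>))"
      unfolding variant_def using \<pi>(1) by auto
    show "rule_vars (subst l (Var \<circ> \<pi>), subst r (Var \<circ> \<pi>)) \<inter> C = {}"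
      using \<pi>(2) by (auto simp: rule_vars_def vars_subst)
    have "\<tau> (\<pi> x) = \<sigma> x" if "x \<in> rule_vars (l, r)" for x
      using \<pi> that bij_is_inj[OF \<pi>(1)] by (auto simp: \<tau>_def)
    then show "subst (subst l (Var \<circ> \<pi>)) \<tau> = subst l \<sigma>" "subst (subst r (Var \<circ> \<pi>)) \<tau> = subst r \<sigma>"
      by (auto simp: subst_subst rule_vars_def intro!: subst_cong)
  qed (simp add: \<tau>_def)
qed

lemma PCP_genI:
  "overlap R1 R2 \<rho>1 p \<rho>2 \<Longrightarrow> is_mgu \<sigma> (fst \<rho>1) (subt_at (fst \<rho>2) p) \<Longrightarrow>
    prime_at R (subt_at (subst (fst \<rho>2) \<sigma>) p) \<Longrightarrow>
    (replace_at (subst (fst \<rho>2) \<sigma>) p (subst (snd \<rho>1) \<sigma>), subst (snd \<rho>2) \<sigma>) \<in> PCP_gen R R1 R2"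
  unfolding PCP_gen_def prime_at_def by blast

lemma function_overlap_instance_PCP:
  fixes R1 R2 :: "('f, 'v) rule set"
  assumes inf: "infinite (UNIV :: 'v set)"
    and rules: "(l1, r1) \<in> R1" "(l2, r2) \<in> R2"
    and p: "p \<in> poss l2" "\<nexists>x. subt_at l2 p = Var x"
    and eq: "subst (subt_at l2 p) \<sigma>2 = subst l1 \<sigma>1"
    and prime: "prime_at R (subst l1 \<sigma>1)"
    and not_variant: "p = [] \<Longrightarrow> \<not> variant (l1, r1) (l2, r2)"
  obtains s t \<delta> where "(s, t) \<in> PCP_gen R R1 R2"
    "replace_at (subst l2 \<sigma>2) p (subst r1 \<sigma>1) = subst s \<delta>" "subst r2 \<sigma>2 = subst t \<delta>"
proof -
  have "finite (rule_vars (l2, r2))" by (simp add: rule_vars_def)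
  then obtain l1' r1' \<tau> where var: "variant (l1, r1) (l1', r1')"
    and disj: "rule_vars (l1', r1') \<inter> rule_vars (l2, r2) = {}"
    and \<tau>1: "subst l1' \<tau> = subst l1 \<sigma>1" "subst r1' \<tau> = subst r1 \<sigma>1"
    and "\<And>x. x \<in> rule_vars (l2, r2) \<Longrightarrow> \<tau> x = \<sigma>2 x"
    using disjoint_variant[OF inf] by blast
  then have \<tau>2: "subst l2 \<tau> = subst l2 \<sigma>2" "subst r2 \<tau> = subst r2 \<sigma>2"
    by (auto simp: rule_vars_def intro!: subst_cong)
  have \<tau>p: "subst (subt_at l2 p) \<tau> = subst l1 \<sigma>1"
    using \<tau>2(1) p(1) eq by (metis subt_at_subst)
  then have unif: "subst l1' \<tau> = subst (subt_at l2 p) \<tau>" by (simp add: \<tau>1)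
  obtain \<mu> where \<mu>: "is_mgu \<mu> l1' (subt_at l2 p)" using is_mgu_exists[OF unif] by blast
  obtain \<delta> where \<delta>: "\<And>x. \<tau> x = subst (\<mu> x) \<delta>" using \<mu> unif unfolding is_mgu_def by blast
  have inst: "subst t \<tau> = subst (subst t \<mu>) \<delta>" for t
    unfolding subst_subst \<delta>[symmetric] ..
  have "\<not> variant (l1', r1') (l2, r2)" if "p = []"
    using not_variant[OF that] variant_trans[OF var] by blast
  then have ov: "overlap R1 R2 (l1', r1') p (l2, r2)"
    unfolding overlap_def using rules var variant_refl disj p unif by auto
  have "prime_at R (subst (subst (subt_at l2 p) \<mu>) \<delta>)" using prime by (simp add: \<tau>p flip: inst)
  then have "prime_at R (subst (subt_at l2 p) \<mu>)" by (rule prime_at_subst)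
  then have "(replace_at (subst l2 \<mu>) p (subst r1' \<mu>), subst r2 \<mu>) \<in> PCP_gen R R1 R2"
    using PCP_genI[OF ov, of \<mu> R] \<mu> p(1) by (simp add: subt_at_subst)
  then show thesis
    by (rule that[of _ _ \<delta>]) (use p(1) in \<open>simp_all add: subst_replace_at poss_subst \<tau>1 \<tau>2 flip: inst\<close>)
qed

lemma variable_overlap:
  assumes step: "(subst l \<sigma>, s) \<in> rstep_at R (q @ q')" and q: "q \<in> poss l" "subt_at l q = Var x"
  obtains \<sigma>' where "(s, subst l \<sigma>') \<in> (rstep R)\<^sup>*" "\<And>t. (subst t \<sigma>, subst t \<sigma>') \<in> (rstep R)\<^sup>*"
    "linear l \<Longrightarrow> s = subst l \<sigma>'"
proof -
  have "q \<in> poss (subst l \<sigma>)" "subt_at (subst l \<sigma>) q = \<sigma> x"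
    using q by (simp_all add: poss_subst subt_at_subst)
  then obtain v where "(\<sigma> x, v) \<in> rstep_at R q'" and s: "s = replace_at (subst l \<sigma>) q v"
    using step by (auto simp: rstep_at_append_iff)
  then have v: "(\<sigma> x, v) \<in> rstep R" using rstep_at_subset_rstep by blast
  show thesis
  proof (rule that[of "\<sigma>(x := v)"])
    show "(s, subst l (\<sigma>(x := v))) \<in> (rstep R)\<^sup>*"
      unfolding s using rewrite_closed_rstep v q by (rule rewrite_closed_rtrancl_replace_var)
    show "(subst t \<sigma>, subst t (\<sigma>(x := v))) \<in> (rstep R)\<^sup>*" for t
      using v by (intro rewrite_closed_rtrancl_subst[OF rewrite_closed_rstep]) auto
    show "s = subst l (\<sigma>(x := v))" if "linear l"
      unfolding s using q(1) that q(2) by (rule replace_at_linear_var)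
  qed
qed

lemma root_overlap_cases:
  fixes R1 R2 :: "('f, 'v) rule set"
  assumes inf: "infinite (UNIV :: 'v set)" and lr: "(l, r) \<in> R2"
    and inner: "(subst l \<sigma>, s) \<in> rstep_at R1 q" and prime: "prime_at R (subt_at (subst l \<sigma>) q)"
  obtains
    (critical) "(s, subst r \<sigma>) \<in> rstep (PCP_gen R R1 R2)"
  | (variant) l' r' where "(l', r') \<in> R1" "variant (l', r') (l, r)"
      "vars r' \<subseteq> vars l' \<Longrightarrow> s = subst r \<sigma>"
  | (variable) \<sigma>' where "(s, subst l \<sigma>') \<in> (rstep R1)\<^sup>*" "(subst r \<sigma>, subst r \<sigma>') \<in> (rstep R1)\<^sup>*"
      "linear l \<Longrightarrow> s = subst l \<sigma>'"
proof -
  obtain l' r' \<sigma>' where rule: "(l', r') \<in> R1" and q: "q \<in> poss (subst l \<sigma>)"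
    and l': "subt_at (subst l \<sigma>) q = subst l' \<sigma>'" and s: "s = replace_at (subst l \<sigma>) q (subst r' \<sigma>')"
    using inner by (rule rstep_atE)
  from q show thesis
  proof (cases rule: poss_subst_cases)
    case inside
    have eq: "subst (subt_at l q) \<sigma> = subst l' \<sigma>'" using l' inside by (simp add: subt_at_subst)
    show thesis
    proof (cases "q = [] \<and> Defs.variant (l', r') (l, r)")
      case True
      then show thesis using variant[OF rule] variant_same_reduct[of l' r' l r \<sigma>' \<sigma>] eq s by simp
    next
      case False
      then obtain a b \<delta> where "(a, b) \<in> PCP_gen R R1 R2" "s = subst a \<delta>" "subst r \<sigma> = subst b \<delta>"
        using function_overlap_instance_PCP[OF inf rule lr inside eq] prime l' s by metis
      then show thesis using critical rstepI[of a b _ "[]" a \<delta>] by simp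
    qed
  next
    case (below_variable q1 q2 x)
    show thesis
      using inner[unfolded below_variable(1)] below_variable(2,3)
      by (rule variable_overlap) (rule variable)
  qed
qed

lemma nested_overlap_cases:
  fixes R1 R2 :: "('f, 'v) rule set"
  assumes inf: "infinite (UNIV :: 'v set)"
    and inner: "(u, s) \<in> rstep_at R1 (p @ q)" and outer: "(u, t) \<in> rstep_at R2 p"
    and prime: "prime_at R (subt_at u (p @ q))"
  obtains
    (critical) "(s, t) \<in> rstep (PCP_gen R R1 R2)"
  | (variant) l1 r1 l2 r2 where "(l1, r1) \<in> R1" "(l2, r2) \<in> R2" "variant (l1, r1) (l2, r2)"
      "vars r1 \<subseteq> vars l1 \<Longrightarrow> s = t"
  | (variable) w w' where "(s, w) \<in> (rstep R1)\<^sup>*" "(w, w') \<in> rstep R2" "(t, w') \<in> (rstep R1)\<^sup>*"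
      "left_linear R2 \<Longrightarrow> s = w"
proof -
  obtain l r \<sigma> where lr: "(l, r) \<in> R2" and p: "p \<in> poss u" and l: "subt_at u p = subst l \<sigma>"
    and t: "t = replace_at u p (subst r \<sigma>)" using outer by (rule rstep_atE)
  obtain s' where s': "(subst l \<sigma>, s') \<in> rstep_at R1 q" and s: "s = replace_at u p s'"
    using inner p by (auto simp: rstep_at_append_iff l)
  have "prime_at R (subt_at (subst l \<sigma>) q)" using prime p by (simp add: subt_at_append l)
  with inf lr s' show thesis
  proof (cases rule: root_overlap_cases)
    case critical
    then have "(s, t) \<in> rstep (PCP_gen R R1 R2)"
      unfolding s t using p by (rule rewrite_closed_ctxt[OF rewrite_closed_rstep])
    then show thesis by (rule that(1))
  next
    case (variant l' r')
    then show thesis using that(2)[OF variant(1) lr variant(2)] by (simp add: s t)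
  next
    case (variable \<sigma>')
    note ctxt = rewrite_closed_ctxt[OF rewrite_closed_rtrancl[OF rewrite_closed_rstep] _ p]
    show thesis
    proof (rule that(3))
      show "(s, replace_at u p (subst l \<sigma>')) \<in> (rstep R1)\<^sup>*"
        unfolding s using variable(1) by (rule ctxt)
      show "(replace_at u p (subst l \<sigma>'), replace_at u p (subst r \<sigma>')) \<in> rstep R2"
        using lr p by (rule rstepI)
      show "(t, replace_at u p (subst r \<sigma>')) \<in> (rstep R1)\<^sup>*"
        unfolding t using variable(2) by (rule ctxt)
      show "s = replace_at u p (subst l \<sigma>')" if "left_linear R2"
        using variable(3) lr that by (auto simp: left_linear_def s)
    qed
  qed
qed

section \<open>Church-Rosser modulo an equivalence\<close>

definition below :: "'a rel \<Rightarrow> 'a rel \<Rightarrow> 'a \<Rightarrow> 'a rel" where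
  "below gt S u = (S \<inter> gt `` {u} \<times> gt `` {u})\<^sup>*"

lemma below_refl [simp]: "(a, a) \<in> below gt S u"
  by (simp add: below_def)

lemma below_trans: "(a, b) \<in> below gt S u \<Longrightarrow> (b, c) \<in> below gt S u \<Longrightarrow> (a, c) \<in> below gt S u"
  by (auto simp: below_def)

lemma below_sym:
  assumes "sym S" "(a, b) \<in> below gt S u"
  shows "(b, a) \<in> below gt S u"
proof -
  have "sym (below gt S u)"
    unfolding below_def by (rule sym_rtrancl) (use assms(1) in \<open>auto simp: sym_def\<close>)
  then show ?thesis using assms(2) by (rule symD)
qed

lemma below_mono: "gt `` {u} \<subseteq> gt `` {v} \<Longrightarrow> (a, b) \<in> below gt S u \<Longrightarrow> (a, b) \<in> below gt S v"
  unfolding below_def by (erule rtrancl_mono[THEN subsetD, rotated]) auto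

lemma relcomp_below_trans:
  "(a, b) \<in> R O below gt S u \<Longrightarrow> (b, c) \<in> below gt S u \<Longrightarrow> (a, c) \<in> R O below gt S u"
  by (blast intro: below_trans)

lemma rtrancl_below:
  assumes "(a, b) \<in> T\<^sup>*" "(u, a) \<in> gt" "T \<subseteq> S"
    and closed: "\<And>x y. (u, x) \<in> gt \<Longrightarrow> (x, y) \<in> T \<Longrightarrow> (u, y) \<in> gt"
  shows "(u, b) \<in> gt \<and> (a, b) \<in> below gt S u"
  using assms(1)
proof (induction rule: rtrancl_induct)
  case base
  then show ?case using assms(2) by simp
next
  case (step y z)
  then have "(u, z) \<in> gt" using closed by blast
  moreover have "(y, z) \<in> below gt S u"
    unfolding below_def using step assms(3) calculation by (intro r_into_rtrancl) auto
  ultimately show ?case using step.IH below_trans by metis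
qed

definition normal_forms :: "'a rel \<Rightarrow> 'a \<Rightarrow> 'a set" where
  "normal_forms R a = {n. (a, n) \<in> R\<^sup>* \<and> n \<notin> Domain R}"

lemma normal_forms_exist:
  assumes "wf (R\<inverse>)"
  shows "normal_forms R a \<noteq> {}"
proof -
  obtain n where "n \<in> R\<^sup>* `` {a}" "\<And>b. (b, n) \<in> R\<inverse> \<Longrightarrow> b \<notin> R\<^sup>* `` {a}"
    using wfE_min[OF assms, of a "R\<^sup>* `` {a}"] by blast
  then have "n \<in> normal_forms R a"
    unfolding normal_forms_def by (auto intro: rtrancl_into_rtrancl)
  then show ?thesis by blast
qed

lemma normal_forms_step: "(a, b) \<in> R \<Longrightarrow> normal_forms R b \<subseteq> normal_forms R a"
  by (auto simp: normal_forms_def)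

lemma normal_forms_of_normal_form: "a \<notin> Domain R \<Longrightarrow> normal_forms R a = {a}"
  by (auto simp: normal_forms_def elim: converse_rtranclE)

lemma normal_forms_reducible:
  assumes "a \<in> Domain R" "n \<in> normal_forms R a"
  obtains b where "(a, b) \<in> R" "n \<in> normal_forms R b"
  using assms by (auto simp: normal_forms_def elim: converse_rtranclE)

locale locally_connected_modulo =
  fixes R S gt :: "'a rel"
  assumes wf: "wf (gt\<inverse>)" and R_gt: "R \<subseteq> gt" and S: "sym S"
    and S_gt: "\<And>u v w. (u, v) \<in> S \<Longrightarrow> (v, w) \<in> gt \<Longrightarrow> (u, w) \<in> gt"
    and peak: "\<And>u s t. (u, s) \<in> R \<Longrightarrow> (u, t) \<in> R \<Longrightarrow> (s, t) \<in> below gt (R \<union> R\<inverse> \<union> S) u"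
    and cliff: "\<And>u s t. (u, s) \<in> R \<Longrightarrow> (u, t) \<in> S \<Longrightarrow> (t, s) \<in> R O below gt (R \<union> R\<inverse> \<union> S) u"
begin

abbreviation conv_step :: "'a rel" where
  "conv_step \<equiv> R \<union> R\<inverse> \<union> S"

lemma normal_forms_nonempty: "normal_forms R a \<noteq> {}"
  using R_gt by (intro normal_forms_exist wf_subset[OF wf]) auto

lemma rtrancl_S_sym: "(a, b) \<in> S\<^sup>* \<Longrightarrow> (b, a) \<in> S\<^sup>*"
  using sym_rtrancl[OF S] by (rule symD)

lemma rtrancl_S_gt: "(u, v) \<in> S\<^sup>* \<Longrightarrow> (v, w) \<in> gt \<Longrightarrow> (u, w) \<in> gt"
  by (induction rule: converse_rtrancl_induct) (blast intro: S_gt)+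

lemma rtrancl_S_below:
  assumes "(u, v) \<in> S\<^sup>*"
  shows "below gt conv_step v \<subseteq> below gt conv_step u"
  using rtrancl_S_gt[OF assms] by (auto intro: below_mono[rotated])

lemma step_along_S:
  assumes "(u, s) \<in> R" "(u, v) \<in> S\<^sup>*"
  shows "(v, s) \<in> R O below gt conv_step u"
  using assms(2)
proof (induction rule: rtrancl_induct)
  case base
  show ?case using assms(1) below_refl by (rule relcompI)
next
  case (step y z)
  then obtain s' where s': "(y, s') \<in> R" "(s', s) \<in> below gt conv_step u" by blast
  have "(z, s') \<in> R O below gt conv_step u"
    using cliff[OF s'(1) step(2)] rtrancl_S_below[OF step(1)] by blast
  then show ?case using s'(2) by (rule relcomp_below_trans)
qed

definition unique_normal_forms_mod :: "'a \<Rightarrow> bool" where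
  "unique_normal_forms_mod u \<longleftrightarrow>
    (\<forall>v n m. (u, v) \<in> S\<^sup>* \<longrightarrow> n \<in> normal_forms R u \<longrightarrow> m \<in> normal_forms R v \<longrightarrow> (n, m) \<in> S\<^sup>*)"

lemma unique_normal_forms_modD:
  "unique_normal_forms_mod u \<Longrightarrow> (u, v) \<in> S\<^sup>* \<Longrightarrow> n \<in> normal_forms R u \<Longrightarrow> m \<in> normal_forms R v \<Longrightarrow>
    (n, m) \<in> S\<^sup>*"
  unfolding unique_normal_forms_mod_def by blast

lemma normal_forms_conversion:
  assumes "(a, b) \<in> (conv_step \<inter> P \<times> P)\<^sup>*" "a \<in> P" and P: "\<And>x. x \<in> P \<Longrightarrow> unique_normal_forms_mod x"
    and n: "n \<in> normal_forms R a" and m: "m \<in> normal_forms R b"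
  shows "(n, m) \<in> S\<^sup>*"
  using assms(1) m
proof (induction arbitrary: m rule: rtrancl_induct)
  case base
  then show ?case by (rule unique_normal_forms_modD[OF P[OF assms(2)] rtrancl_refl n])
next
  case (step y z)
  have yz: "unique_normal_forms_mod y" "unique_normal_forms_mod z" using step(2) P by auto
  obtain k where k: "k \<in> normal_forms R y" using normal_forms_nonempty by blast
  have "(k, m) \<in> S\<^sup>*"
  proof -
    from step(2) consider (forward) "(y, z) \<in> R" | (backward) "(z, y) \<in> R" | (side) "(y, z) \<in> S"
      by blast
    then show ?thesis
    proof cases
      case forward
      then have "m \<in> normal_forms R y" using step.prems normal_forms_step by fast
      then show ?thesis by (rule unique_normal_forms_modD[OF yz(1) rtrancl_refl k])
    next
      case backward
      then have "k \<in> normal_forms R z" using k normal_forms_step by fast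
      then show ?thesis using step.prems by (rule unique_normal_forms_modD[OF yz(2) rtrancl_refl])
    next
      case side
      then show ?thesis
        using step.prems by (intro unique_normal_forms_modD[OF yz(1) _ k] r_into_rtrancl)
    qed
  qed
  then show ?case using step.IH[OF k] by (rule rtrancl_trans[rotated])
qed

lemma unique_normal_forms_mod_all: "unique_normal_forms_mod u"
  using wf
proof (induction u rule: wf_induct_rule)
  case (less u)
  show ?case
    unfolding unique_normal_forms_mod_def
  proof (intro allI impI)
    fix v n m
    assume uv: "(u, v) \<in> S\<^sup>*" and n: "n \<in> normal_forms R u" and m: "m \<in> normal_forms R v"
    show "(n, m) \<in> S\<^sup>*"
    proof (cases "u \<in> Domain R")
      case False
      then have "v \<notin> Domain R" using step_along_S[OF _ rtrancl_S_sym[OF uv]] by blast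
      then show ?thesis using False uv n m by (simp add: normal_forms_of_normal_form)
    next
      case True
      then obtain u' where u': "(u, u') \<in> R" "n \<in> normal_forms R u'"
        using n by (rule normal_forms_reducible)
      have "v \<in> Domain R" using step_along_S[OF u'(1) uv] by blast
      then obtain v' where v': "(v, v') \<in> R" "m \<in> normal_forms R v'"
        using m by (rule normal_forms_reducible)
      obtain w where w: "(u, w) \<in> R" "(w, v') \<in> below gt conv_step v"
        using step_along_S[OF v'(1) rtrancl_S_sym[OF uv]] by blast
      then have "(w, v') \<in> below gt conv_step u" using rtrancl_S_below[OF uv] by blast
      with peak[OF u'(1) w(1)] have "(u', v') \<in> below gt conv_step u" by (rule below_trans)
      then have conversion: "(u', v') \<in> (conv_step \<inter> gt `` {u} \<times> gt `` {u})\<^sup>*"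
        by (simp add: below_def)
      show ?thesis
      proof (rule normal_forms_conversion[OF conversion _ _ u'(2) v'(2)])
        show "u' \<in> gt `` {u}" using u'(1) R_gt by blast
        show "unique_normal_forms_mod x" if "x \<in> gt `` {u}" for x
          using less[of x] that by simp
      qed
    qed
  qed
qed

theorem Church_Rosser_modulo: "conv_step\<^sup>* \<subseteq> R\<^sup>* O S\<^sup>* O (R\<inverse>)\<^sup>*"
proof (rule subrelI)
  fix a b
  assume ab: "(a, b) \<in> conv_step\<^sup>*"
  obtain n where n: "n \<in> normal_forms R a" using normal_forms_nonempty by blast
  obtain m where m: "m \<in> normal_forms R b" using normal_forms_nonempty by blast
  have "(a, n) \<in> R\<^sup>*" "(b, m) \<in> R\<^sup>*" using n m by (simp_all add: normal_forms_def)
  moreover have "(n, m) \<in> S\<^sup>*"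
    using ab
    by (intro normal_forms_conversion[where P = UNIV, OF _ _ unique_normal_forms_mod_all n m]) simp_all
  ultimately show "(a, b) \<in> R\<^sup>* O S\<^sup>* O (R\<inverse>)\<^sup>*"
    unfolding rtrancl_converse by blast
qed

end

section \<open>Compatible reduction orders\<close>

locale compatible_order =
  fixes B :: "('f, 'v) rule set" and gt :: "('f, 'v) trm rel"
  assumes order: "B_compatible_reduction_order B gt"
begin

lemma gt_trans: "(s, t) \<in> gt \<Longrightarrow> (t, u) \<in> gt \<Longrightarrow> (s, u) \<in> gt"
  using order unfolding B_compatible_reduction_order_def by (meson transD)

lemma gt_irrefl: "(s, s) \<notin> gt"
  using order unfolding B_compatible_reduction_order_def by (meson irreflD)

lemma SN_gt: "SN_rel gt"
  using order unfolding B_compatible_reduction_order_def by blast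

lemma wf_gt: "wf (gt\<inverse>)"
  using SN_gt by (simp add: SN_rel_def wf_iff_no_infinite_down_chain)

lemma gt_simB: "(s, t) \<in> gt \<Longrightarrow> (t, u) \<in> simB B \<Longrightarrow> (s, u) \<in> gt"
  using order simB_refl[of s B] unfolding B_compatible_reduction_order_def by blast

lemma simB_gt: "(s, t) \<in> simB B \<Longrightarrow> (t, u) \<in> gt \<Longrightarrow> (s, u) \<in> gt"
  using order simB_refl[of u B] unfolding B_compatible_reduction_order_def by blast

lemma gt_not_simB: "(s, t) \<in> gt \<Longrightarrow> (s, t) \<notin> simB B"
  using gt_simB simB_sym gt_irrefl by blast

lemma rewrite_closed_gt: "rewrite_closed gt"
  using order unfolding B_compatible_reduction_order_def by (intro rewrite_closedI) simp

lemma rstep_subset_gt: "R \<subseteq> gt \<Longrightarrow> rstep R \<subseteq> gt"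
  by (rule rstep_least[OF rewrite_closed_gt])

lemma rel_mod_subset_gt: "R \<subseteq> gt \<Longrightarrow> rel_mod R B \<subseteq> gt"
  using rstep_subset_gt[of R] gt_simB simB_gt unfolding rel_mod_def by blast

lemma terminating_modI: "R \<subseteq> gt \<Longrightarrow> terminating_mod R B"
  using rel_mod_subset_gt[of R] SN_gt unfolding terminating_mod_def SN_rel_def by blast

lemma not_gt_superterm:
  assumes "p \<in> poss t"
  shows "(s, replace_at t p s) \<notin> gt"
proof
  let ?C = "replace_at t p"
  assume "(s, ?C s) \<in> gt"
  then have "((?C ^^ i) s, (?C ^^ Suc i) s) \<in> gt" for i
    using rewrite_closed_ctxt[OF rewrite_closed_gt _ assms] by (induction i) simp_all
  then have "\<exists>f. \<forall>i. (f i, f (Suc i)) \<in> gt" by (intro exI[of _ "\<lambda>i. (?C ^^ i) s"] allI)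
  then show False using SN_gt by (simp add: SN_rel_def)
qed

lemma gt_vars_subset:
  assumes "(s, t) \<in> gt"
  shows "vars t \<subseteq> vars s"
proof (rule subsetI, rule ccontr)
  fix x
  assume x: "x \<in> vars t" "x \<notin> vars s"
  obtain p where p: "p \<in> poss t" "subt_at t p = Var x" using vars_obtain_pos[OF x(1)] .
  let ?t = "subst t (Var(x := s))"
  have pt: "p \<in> poss ?t" "subt_at ?t p = s" using p by (simp_all add: poss_subst subt_at_subst)
  have "subst s (Var(x := s)) = subst s Var" using x(2) by (intro subst_cong) auto
  then have "(s, ?t) \<in> gt"
    using rewrite_closed_subst[OF rewrite_closed_gt assms, of "Var(x := s)"] by simp
  then show False using not_gt_superterm[OF pt(1), of s] replace_at_subt_at[OF pt(1)] pt(2) by simp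
qed

end

locale compatible_trs = compatible_order B gt
  for B :: "('f, 'v) rule set" and gt :: "('f, 'v) trm rel" +
  fixes R :: "('f, 'v) rule set"
  assumes R_gt: "R \<subseteq> gt"
begin

abbreviation conv_below :: "('f, 'v) trm \<Rightarrow> ('f, 'v) trm rel" where
  "conv_below \<equiv> below gt (sstep (R \<union> B))"

lemma rstep_gt: "(s, t) \<in> rstep R \<Longrightarrow> (s, t) \<in> gt"
  using rstep_subset_gt[OF R_gt] by blast

lemma rstep_at_gt: "(s, t) \<in> rstep_at R p \<Longrightarrow> (s, t) \<in> gt"
  using rstep_at_subset_rstep rstep_gt by blast

lemma conv_below_sym: "(s, t) \<in> conv_below u \<Longrightarrow> (t, s) \<in> conv_below u"
  by (rule below_sym[OF sym_sstep])

lemma conv_below_gt: "(v, u) \<in> gt \<Longrightarrow> (s, t) \<in> conv_below u \<Longrightarrow> (s, t) \<in> conv_below v"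
  by (erule below_mono[rotated]) (auto intro: gt_trans)

lemma conv_below_simB: "(v, u) \<in> simB B \<Longrightarrow> (s, t) \<in> conv_below u \<Longrightarrow> (s, t) \<in> conv_below v"
  by (erule below_mono[rotated]) (auto intro: simB_gt)

lemma rsteps_conv_below:
  assumes "(s, t) \<in> (rstep R)\<^sup>*" "(u, s) \<in> gt"
  shows "(u, t) \<in> gt" "(s, t) \<in> conv_below u"
proof -
  have "rstep R \<subseteq> sstep (R \<union> B)" by (auto simp: sstep_def rstep_Un)
  then have "(u, t) \<in> gt \<and> (s, t) \<in> conv_below u"
    using assms by (intro rtrancl_below[where T = "rstep R"]) (auto intro: gt_trans rstep_gt)
  then show "(u, t) \<in> gt" "(s, t) \<in> conv_below u" by simp_all
qed

lemma simB_conv_below: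
  assumes "(s, t) \<in> simB B" "(u, s) \<in> gt"
  shows "(s, t) \<in> conv_below u"
proof -
  have "(s, t) \<in> (sstep B)\<^sup>*" using assms(1) by (simp add: simB_def conv_def)
  moreover have "(u, y) \<in> gt" if "(u, x) \<in> gt" "(x, y) \<in> sstep B" for x y
    using that gt_simB sstep_subset_simB by blast
  ultimately show ?thesis
    using rtrancl_below[of s t "sstep B" u gt] assms(2) by (simp add: sstep_Un)
qed

lemma join_mod_conv_below:
  assumes "(s, t) \<in> join_mod R B" "(u, s) \<in> gt" "(u, t) \<in> gt"
  shows "(s, t) \<in> conv_below u"
proof -
  obtain s' t' where s': "(s, s') \<in> (rstep R)\<^sup>*" and "(s', t') \<in> simB B"
    and t': "(t, t') \<in> (rstep R)\<^sup>*"
    using assms(1) unfolding join_mod_iff by blast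
  then have "(s', t') \<in> conv_below u" using rsteps_conv_below(1) assms(2) by (intro simB_conv_below)
  then show ?thesis
    using rsteps_conv_below(2)[OF s' assms(2)] rsteps_conv_below(2)[OF t' assms(3)]
    by (blast intro: below_trans conv_below_sym)
qed

lemma join_mod_cliff:
  assumes "(s, t) \<in> join_mod R B" "(u, s) \<in> gt" "(u, t) \<in> simB B"
  shows "(t, s) \<in> rstep R O conv_below u"
proof -
  obtain s' t' where s': "(s, s') \<in> (rstep R)\<^sup>*" and B: "(s', t') \<in> simB B"
    and t': "(t, t') \<in> (rstep R)\<^sup>*"
    using assms(1) unfolding join_mod_iff by blast
  have "(u, t') \<in> gt" using rsteps_conv_below(1)[OF s' assms(2)] B by (rule gt_simB)
  then have "t \<noteq> t'" using gt_not_simB assms(3) by blast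
  then obtain t'' where t'': "(t, t'') \<in> rstep R" "(t'', t') \<in> (rstep R)\<^sup>*"
    using t' by (blast elim: converse_rtranclE)
  have "(u, t'') \<in> gt" using assms(3) rstep_gt[OF t''(1)] by (rule simB_gt)
  moreover have "(t'', s) \<in> join_mod R B" using t''(2) simB_sym[OF B] s' by (rule join_modI)
  ultimately have "(t'', s) \<in> conv_below u" using assms(2) by (intro join_mod_conv_below)
  then show ?thesis using t''(1) by blast
qed

text \<open>Connectedness below all common upper bounds is not closed under contexts, since an upper bound
  of \<open>C[s]\<close> and \<open>C[t]\<close> need not have the form \<open>C[u]\<close>; hence the rewrite cores.\<close>

definition connected :: "('f, 'v) trm rel" where
  "connected = rewrite_core {(s, t). \<forall>u. (u, s) \<in> gt \<longrightarrow> (u, t) \<in> gt \<longrightarrow> (s, t) \<in> conv_below u}"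

definition simulated :: "('f, 'v) trm rel" where
  "simulated = rewrite_core (gt \<inter> {(s, t). (s, t) \<in> rstep R O conv_below s})"

lemma rewrite_closed_connected: "rewrite_closed connected"
  unfolding connected_def by (rule rewrite_closed_core)

lemma rewrite_closed_simulated: "rewrite_closed simulated"
  unfolding simulated_def by (rule rewrite_closed_core)

lemma connectedD: "(s, t) \<in> connected \<Longrightarrow> (u, s) \<in> gt \<Longrightarrow> (u, t) \<in> gt \<Longrightarrow> (s, t) \<in> conv_below u"
  using rewrite_core_subset unfolding connected_def by blast

lemma simulated_gt: "(s, t) \<in> simulated \<Longrightarrow> (s, t) \<in> gt"
  using rewrite_core_subset unfolding simulated_def by blast

lemma simulatedD: "(s, t) \<in> simulated \<Longrightarrow> (s, t) \<in> rstep R O conv_below s"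
  using rewrite_core_subset unfolding simulated_def by blast

lemma subset_connectedI:
  assumes "rewrite_closed S"
    and "\<And>s t u. (s, t) \<in> S \<Longrightarrow> (u, s) \<in> gt \<Longrightarrow> (u, t) \<in> gt \<Longrightarrow> (s, t) \<in> conv_below u"
  shows "S \<subseteq> connected"
  unfolding connected_def using assms by (intro rewrite_core_greatest) auto

lemma subset_simulatedI:
  assumes "rewrite_closed S" "S \<subseteq> gt" "\<And>s t. (s, t) \<in> S \<Longrightarrow> (s, t) \<in> rstep R O conv_below s"
  shows "S \<subseteq> simulated"
  unfolding simulated_def using assms by (intro rewrite_core_greatest) auto

lemma sym_connected: "sym connected"
proof -
  have "connected\<inverse> \<subseteq> connected"
    using rewrite_closed_connected
    by (intro subset_connectedI rewrite_closed_converse) (auto intro: connectedD conv_below_sym)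
  then show ?thesis by (auto simp: sym_def)
qed

lemma simB_subset_connected: "simB B \<subseteq> connected"
  by (rule subset_connectedI[OF rewrite_closed_simB]) (rule simB_conv_below)

lemma join_mod_subset_connected: "join_mod R B \<subseteq> connected"
  by (rule subset_connectedI[OF rewrite_closed_join_mod]) (rule join_mod_conv_below)

lemma rstep_subset_simulated: "rstep R \<subseteq> simulated"
  by (rule subset_simulatedI[OF rewrite_closed_rstep]) (auto intro: rstep_gt relcompI[OF _ below_refl])

lemma simulated_subset_connected: "simulated \<subseteq> connected"
proof (rule subset_connectedI[OF rewrite_closed_simulated])
  fix s t u
  assume "(s, t) \<in> simulated" and u: "(u, s) \<in> gt"
  then obtain s' where s': "(s, s') \<in> rstep R" "(s', t) \<in> conv_below s" using simulatedD by blast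
  have "(s, s') \<in> conv_below u" using r_into_rtrancl[OF s'(1)] u by (rule rsteps_conv_below(2))
  then show "(s, t) \<in> conv_below u" using conv_below_gt[OF u s'(2)] by (rule below_trans)
qed

lemma connected_trans:
  assumes "(s, u) \<in> connected" "(s, u) \<in> gt \<union> simB B" "(u, t) \<in> connected"
  shows "(s, t) \<in> connected"
proof -
  have "(connected \<inter> (gt \<union> simB B)) O connected \<subseteq> connected"
  proof (rule subset_connectedI)
    fix s t w
    assume "(s, t) \<in> (connected \<inter> (gt \<union> simB B)) O connected" and w: "(w, s) \<in> gt" "(w, t) \<in> gt"
    then obtain u where u: "(s, u) \<in> connected" "(s, u) \<in> gt \<union> simB B" "(u, t) \<in> connected" by blast
    then have "(w, u) \<in> gt" using w(1) gt_trans gt_simB by blast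
    then show "(s, t) \<in> conv_below w" using u w by (blast intro: connectedD below_trans)
  qed (intro rewrite_closed_relcomp rewrite_closed_Int rewrite_closed_Un rewrite_closed_connected
      rewrite_closed_gt rewrite_closed_simB)
  then show ?thesis using assms by blast
qed

lemma simulated_trans:
  assumes "(s, u) \<in> simulated" "(u, t) \<in> connected" "(s, t) \<in> gt"
  shows "(s, t) \<in> simulated"
proof -
  have "simulated O connected \<inter> gt \<subseteq> simulated"
  proof (rule subset_simulatedI)
    fix s t
    assume "(s, t) \<in> simulated O connected \<inter> gt"
    then obtain u where u: "(s, u) \<in> simulated" "(u, t) \<in> connected" and st: "(s, t) \<in> gt" by blast
    have "(u, t) \<in> conv_below s"
      using u(2) simulated_gt[OF u(1)] st by (rule connectedD)
    with simulatedD[OF u(1)] show "(s, t) \<in> rstep R O conv_below s" by (rule relcomp_below_trans)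
  qed (auto intro!: rewrite_closed_relcomp rewrite_closed_Int rewrite_closed_connected
      rewrite_closed_simulated rewrite_closed_gt)
  then show ?thesis using assms by blast
qed

end

section \<open>Local confluence from prime critical pairs\<close>

locale prime_critical_pairs_connected = compatible_trs B gt R
  for B :: "('f, 'v) rule set" and gt :: "('f, 'v) trm rel" and R :: "('f, 'v) rule set" +
  assumes infinite_vars: "infinite (UNIV :: 'v set)"
    and left_linear: "left_linear R"
    and PCP: "PCP R \<subseteq> connected"
    and PCP_pm: "PCP_pm R B \<subseteq> join_mod R B \<union> (simulated \<union> simulated\<inverse>)"
begin

lemma critical_cliff:
  assumes "(s, t) \<in> sstep (PCP_pm R B)" "(u, s) \<in> gt" "(u, t) \<in> simB B"
  shows "(t, s) \<in> rstep R O conv_below u"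
proof -
  have "sstep (PCP_pm R B) \<subseteq> join_mod R B \<union> (simulated \<union> simulated\<inverse>)"
    using PCP_pm
    by (intro sstep_least rewrite_closed_Un rewrite_closed_join_mod rewrite_closed_converse
        rewrite_closed_simulated) (auto simp: sym_def intro: join_mod_sym)
  then consider (join) "(s, t) \<in> join_mod R B" | (forward) "(s, t) \<in> simulated"
    | (backward) "(t, s) \<in> simulated"
    using assms(1) by blast
  then show ?thesis
  proof cases
    case join
    then show ?thesis using assms(2,3) by (rule join_mod_cliff)
  next
    case forward
    then have "(u, t) \<in> gt" using assms(2) simulated_gt gt_trans by blast
    then show ?thesis using gt_not_simB assms(3) by blast
  next
    case backward
    then show ?thesis using simulatedD conv_below_simB[OF assms(3)] by blast
  qed
qed

lemma prime_peak:
  assumes inner: "(u, s) \<in> rstep_at R (p @ q)" and outer: "(u, t) \<in> rstep_at R p"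
    and prime: "prime_at R (subt_at u (p @ q))"
  shows "(s, t) \<in> conv_below u"
proof -
  from infinite_vars inner outer prime have "(s, t) \<in> connected"
  proof (cases rule: nested_overlap_cases)
    case critical
    then show ?thesis using rstep_least[OF rewrite_closed_connected PCP] by (auto simp: PCP_def)
  next
    case (variant l1 r1 l2 r2)
    then have "s = t" using gt_vars_subset R_gt by blast
    then show ?thesis using simB_subset_connected by auto
  next
    case (variable w w')
    then have "(s, w') \<in> (rstep R)\<^sup>*" by simp
    then have "(s, t) \<in> join_mod R B" using simB_refl variable(3) by (rule join_modI)
    then show ?thesis using join_mod_subset_connected by blast
  qed
  then show ?thesis using rstep_at_gt[OF inner] rstep_at_gt[OF outer] by (rule connectedD)
qed

lemma prime_cliff_R_inside_B:
  assumes inner: "(u, s) \<in> rstep_at R (p @ q)" and outer: "(u, t) \<in> rstep_at (Bpm B) p"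
    and prime: "prime_at R (subt_at u (p @ q))"
  shows "(t, s) \<in> rstep R O conv_below u"
proof -
  have us: "(u, s) \<in> gt" and ut: "(u, t) \<in> simB B"
    using rstep_at_gt[OF inner] rstep_at_Bpm_simB[OF outer] .
  from infinite_vars inner outer prime show ?thesis
  proof (cases rule: nested_overlap_cases)
    case critical
    then have "(s, t) \<in> sstep (PCP_pm R B)" by (simp add: PCP_pm_def sstep_def rstep_Un)
    then show ?thesis using us ut by (rule critical_cliff)
  next
    case (variant l1 r1 l2 r2)
    then have "(l2, r2) \<in> gt" using variant_rewrite_closed[OF rewrite_closed_gt] R_gt by blast
    then show ?thesis using variant(2) Bpm_subset_simB gt_not_simB by blast
  next
    case (variable w w')
    have "(s, t) \<in> join_mod R B"
      using variable(1) rstep_Bpm_simB[OF variable(2)] variable(3) by (rule join_modI)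
    then show ?thesis using us ut by (rule join_mod_cliff)
  qed
qed

lemma prime_cliff_B_inside_R:
  assumes inner: "(u, t) \<in> rstep_at (Bpm B) (p @ q)" and outer: "(u, s) \<in> rstep_at R p"
    and prime: "prime_at R (subt_at u (p @ q))"
  shows "(t, s) \<in> rstep R O conv_below u"
proof -
  have us: "(u, s) \<in> gt" and ut: "(u, t) \<in> simB B"
    using rstep_at_gt[OF outer] rstep_at_Bpm_simB[OF inner] .
  from infinite_vars inner outer prime show ?thesis
  proof (cases rule: nested_overlap_cases)
    case critical
    then have "(s, t) \<in> sstep (PCP_pm R B)" by (simp add: PCP_pm_def sstep_def rstep_Un)
    then show ?thesis using us ut by (rule critical_cliff)
  next
    case (variant l1 r1 l2 r2)
    then have "(l2, r2) \<in> simB B"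
      using variant_rewrite_closed[OF rewrite_closed_simB] Bpm_subset_simB by blast
    then show ?thesis using variant(2) R_gt gt_not_simB by blast
  next
    case (variable w w')
    then have "(s, w') \<in> simB B" "(t, w') \<in> (rstep R)\<^sup>*"
      using left_linear rsteps_Bpm_simB by auto
    then have "(s, t) \<in> join_mod R B" by (rule join_modI[OF rtrancl_refl])
    then show ?thesis using us ut by (rule join_mod_cliff)
  qed
qed

lemma rstep_at_innermost:
  assumes "(u, s) \<in> rstep_at R p"
  obtains q v where "(u, v) \<in> rstep_at R (p @ q)" "prime_at R (subt_at u (p @ q))"
    "(v, s) \<in> conv_below u"
proof -
  have p: "p \<in> poss u" using assms by (rule rstep_atE)
  then obtain q v where v: "(u, v) \<in> rstep_at R (p @ q)" "prime_at R (subt_at u (p @ q))"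
    using rstep_at_not_NF[OF assms] by (rule innermost_redex_below)
  show thesis using v prime_peak[OF v(1) assms v(2)] by (rule that)
qed

lemma nested_peak:
  assumes inner: "(u, s) \<in> rstep_at R (p @ q)" and outer: "(u, t) \<in> rstep_at R p"
  shows "(s, t) \<in> conv_below u"
proof -
  obtain q' v where v: "(u, v) \<in> rstep_at R ((p @ q) @ q')" "prime_at R (subt_at u ((p @ q) @ q'))"
    and vs: "(v, s) \<in> conv_below u"
    using inner by (rule rstep_at_innermost)
  note v = v[unfolded append_assoc]
  have "(v, t) \<in> conv_below u" using v(1) outer v(2) by (rule prime_peak)
  then show ?thesis using vs by (blast intro: conv_below_sym below_trans)
qed

lemma nested_cliff_R_inside_B:
  assumes inner: "(u, s) \<in> rstep_at R (p @ q)" and outer: "(u, t) \<in> rstep_at (Bpm B) p"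
  shows "(t, s) \<in> rstep R O conv_below u"
proof -
  obtain q' v where v: "(u, v) \<in> rstep_at R ((p @ q) @ q')" "prime_at R (subt_at u ((p @ q) @ q'))"
    and vs: "(v, s) \<in> conv_below u"
    using inner by (rule rstep_at_innermost)
  note v = v[unfolded append_assoc]
  have "(t, v) \<in> rstep R O conv_below u" using v(1) outer v(2) by (rule prime_cliff_R_inside_B)
  then show ?thesis using vs by (rule relcomp_below_trans)
qed

lemma nested_cliff_B_inside_R:
  assumes inner: "(u, t) \<in> rstep_at (Bpm B) (p @ q)" and outer: "(u, s) \<in> rstep_at R p"
  shows "(t, s) \<in> rstep R O conv_below u"
proof (cases "prime_at R (subt_at u (p @ q))")
  case True
  with inner outer show ?thesis by (rule prime_cliff_B_inside_R)
next
  case False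
  have pq: "p @ q \<in> poss u" using inner by (rule rstep_atE)
  obtain q' v where v: "(u, v) \<in> rstep_at R ((p @ q) @ q')" "prime_at R (subt_at u ((p @ q) @ q'))"
    using innermost_redex_below[OF pq] False NF_prime_at by metis
  have "(t, v) \<in> rstep R O conv_below u" using v(1) inner v(2) by (rule prime_cliff_R_inside_B)
  moreover have "(v, s) \<in> conv_below u" 
    using v(1)[unfolded append_assoc] outer v(2)[unfolded append_assoc] by (rule prime_peak)
  ultimately show ?thesis by (rule relcomp_below_trans)
qed

lemma local_peak:
  assumes "(u, s) \<in> rstep R" "(u, t) \<in> rstep R"
  shows "(s, t) \<in> conv_below u"
proof -
  obtain p q where s: "(u, s) \<in> rstep_at R p" and t: "(u, t) \<in> rstep_at R q"
    using assms by (auto simp: rstep_iff_rstep_at)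
  show ?thesis
  proof (cases rule: position_cases[of q p])
    case (below r)
    have "(t, s) \<in> conv_below u" using t[unfolded below] s by (rule nested_peak)
    then show ?thesis by (rule conv_below_sym)
  next
    case (above r)
    show ?thesis using s[unfolded above] t by (rule nested_peak)
  next
    case parallel
    with s t obtain w where "(s, w) \<in> rstep_at R q" "(t, w) \<in> rstep_at R p"
      by (rule parallel_rstep_at_commute)
    then have "(s, w) \<in> (rstep R)\<^sup>*" "(t, w) \<in> (rstep R)\<^sup>*" using rstep_at_subset_rstep by blast+
    then have "(s, t) \<in> join_mod R B" by (intro join_modI[OF _ simB_refl])
    then show ?thesis using rstep_gt[OF assms(1)] rstep_gt[OF assms(2)] by (rule join_mod_conv_below)
  qed
qed

lemma local_cliff:
  assumes "(u, s) \<in> rstep R" "(u, t) \<in> sstep B"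
  shows "(t, s) \<in> rstep R O conv_below u"
proof -
  obtain p q where s: "(u, s) \<in> rstep_at R p" and t: "(u, t) \<in> rstep_at (Bpm B) q"
    using assms unfolding rstep_Bpm[symmetric] rstep_iff_rstep_at by blast
  show ?thesis
  proof (cases rule: position_cases[of q p])
    case (below r)
    show ?thesis using t[unfolded below] s by (rule nested_cliff_B_inside_R)
  next
    case (above r)
    show ?thesis using s[unfolded above] t by (rule nested_cliff_R_inside_B)
  next
    case parallel
    with s t obtain w where w: "(s, w) \<in> rstep_at (Bpm B) q" "(t, w) \<in> rstep_at R p"
      by (rule parallel_rstep_at_commute)
    have "(t, w) \<in> (rstep R)\<^sup>*" using w(2) rstep_at_subset_rstep by blast
    then have "(s, t) \<in> join_mod R B" by (rule join_modI[OF rtrancl_refl rstep_at_Bpm_simB[OF w(1)]])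
    then show ?thesis using rstep_gt[OF assms(1)] rstep_at_Bpm_simB[OF t] by (rule join_mod_cliff)
  qed
qed

theorem Church_Rosser: "CR_mod R B"
proof -
  have sstep: "rstep R \<union> (rstep R)\<inverse> \<union> sstep B = sstep (R \<union> B)"
    by (simp add: sstep_Un sstep_def[of R])
  interpret locally_connected_modulo "rstep R" "sstep B" gt
  proof
    show "(u, w) \<in> gt" if "(u, v) \<in> sstep B" "(v, w) \<in> gt" for u v w
      using that sstep_subset_simB simB_gt by blast
  qed (use wf_gt rstep_gt sym_sstep local_peak local_cliff in \<open>auto simp: sstep\<close>)
  show ?thesis
    using Church_Rosser_modulo unfolding sstep CR_mod_def join_mod_def simB_def conv_def .
qed

end

section \<open>Runs\<close>

lemma IA_step_subset_conv:
  assumes "IA_step B gt S S'" and B: "B \<subseteq> conv T"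
    and "fst S \<subseteq> conv T" "snd S \<subseteq> conv T"
  shows "fst S' \<subseteq> conv T \<and> snd S' \<subseteq> conv T"
proof -
  have rstep: "rstep R \<subseteq> conv T" if "R \<subseteq> snd S" for R
    using that assms(4) by (intro rstep_subset_conv) auto
  have rel_mod: "rel_mod R B \<subseteq> conv T" if "R \<subseteq> snd S" for R
    using that assms(4) B by (intro rel_mod_subset_conv) auto
  from assms(1) show ?thesis
  proof cases
    case (deduce_peak s t R E)
    then obtain v where "(v, s) \<in> conv T" "(v, t) \<in> conv T" using rstep[of R] by auto
    then have "(s, t) \<in> conv T" using conv_sym conv_trans by blast
    then show ?thesis using assms(3,4) deduce_peak by simp
  next
    case (deduce_cliff s t R E)
    then obtain v where "(v, s) \<in> conv T" "(v, t) \<in> conv T"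
      using rstep[of R] sstep_subset_conv[OF B] by auto
    then have "(t, s) \<in> conv T" using conv_sym conv_trans by blast
    then show ?thesis using assms(3,4) deduce_cliff by simp
  next
    case (simplify e E s t u R)
    then have "(s, t) \<in> conv T" using assms(3) by (auto intro: conv_sym)
    moreover have "(s, u) \<in> conv T" using simplify rel_mod[of R] by auto
    ultimately have "(u, t) \<in> conv T" using conv_sym conv_trans by blast
    then show ?thesis using assms(3,4) simplify by auto
  next
    case (collapse s t R u E)
    then have "(s, t) \<in> conv T" "(s, u) \<in> conv T" using assms(4) rstep[of "R - {(s, t)}"] by auto
    then have "(u, t) \<in> conv T" using conv_sym conv_trans by blast
    then show ?thesis using assms(3,4) collapse by auto
  next
    case (compose s t R u E)
    then have "(s, t) \<in> conv T" "(t, u) \<in> conv T" using assms(4) rel_mod[of "R - {(s, t)}"] by auto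
    then have "(s, u) \<in> conv T" by (rule conv_trans)
    then show ?thesis using assms(3,4) compose by auto
  qed (use assms(3,4) in \<open>auto intro: conv_sym\<close>)
qed

lemma run_subset_conv:
  assumes "is_run B gt E run n" "i \<le> n"
  shows "fst (run i) \<subseteq> conv (E \<union> B) \<and> snd (run i) \<subseteq> conv (E \<union> B)"
  using assms(2)
proof (induction i)
  case 0
  then show ?case using assms(1) subset_conv[of "E \<union> B"] by (simp add: is_run_def)
next
  case (Suc i)
  then have "IA_step B gt (run i) (run (Suc i))" using assms(1) by (simp add: is_run_def)
  then show ?case using Suc subset_conv[of "E \<union> B"] by (intro IA_step_subset_conv) auto
qed

context compatible_order
begin

lemma IA_step_subset_gt:
  assumes "IA_step B gt S S'" "snd S \<subseteq> gt"
  shows "snd S' \<subseteq> gt"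
  using assms(1)
proof cases
  case (deduce_cliff s t R E)
  then obtain u where "(u, s) \<in> gt" "(u, t) \<in> simB B"
    using assms(2) rstep_subset_gt[of R] sstep_subset_simB[of B] by auto
  then have "(t, s) \<in> gt" using simB_gt simB_sym by blast
  then show ?thesis using assms(2) deduce_cliff by simp
next
  case (compose s t R u E)
  then have "(s, t) \<in> gt" "(t, u) \<in> gt"
    using assms(2) rel_mod_subset_gt[of "R - {(s, t)}"] by auto
  then have "(s, u) \<in> gt" by (rule gt_trans)
  then show ?thesis using assms(2) compose by auto
qed (use assms(2) in auto)

lemma run_rules_gt:
  assumes "is_run B gt E run n" "i \<le> n"
  shows "snd (run i) \<subseteq> gt"
  using assms(2)
proof (induction i)
  case 0
  then show ?case using assms(1) by (simp add: is_run_def)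
next
  case (Suc i)
  then show ?case using assms(1) IA_step_subset_gt[of "run i" "run (Suc i)"] by (simp add: is_run_def)
qed

end

text \<open>\<open>EQ\<close> and \<open>RL\<close> stand for what is known about the equations and rules at the end of a run;
  the closure conditions are those needed to undo single inference steps.\<close>

locale backward_invariant = compatible_order B gt
  for B :: "('f, 'v) rule set" and gt :: "('f, 'v) trm rel" +
  fixes EQ RL :: "('f, 'v) trm rel"
  assumes rewrite_closed_RL: "rewrite_closed RL"
    and sym_EQ: "sym EQ"
    and RL_EQ: "RL \<subseteq> EQ"
    and simB_EQ: "simB B \<subseteq> EQ"
    and EQ_trans: "\<And>s t u. (s, u) \<in> EQ \<Longrightarrow> (s, u) \<in> gt \<union> simB B \<Longrightarrow> (u, t) \<in> EQ \<Longrightarrow> (s, t) \<in> EQ"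
    and RL_trans: "\<And>s t u. (s, u) \<in> RL \<Longrightarrow> (u, t) \<in> EQ \<Longrightarrow> (s, t) \<in> gt \<Longrightarrow> (s, t) \<in> RL"
begin

lemma EQ_sym: "(s, t) \<in> EQ \<Longrightarrow> (t, s) \<in> EQ"
  using sym_EQ by (rule symD)

lemma rel_mod_EQ:
  assumes "R \<subseteq> gt" "R \<subseteq> RL"
  shows "rel_mod R B \<subseteq> EQ"
proof (rule subrelI)
  fix s t
  assume "(s, t) \<in> rel_mod R B"
  then obtain s' t' where st: "(s, s') \<in> simB B" "(s', t') \<in> rstep R" "(t', t) \<in> simB B"
    unfolding rel_mod_def by blast
  have "(s', t') \<in> gt" "(s', t') \<in> EQ"
    using st(2) rstep_subset_gt[OF assms(1)] rstep_least[OF rewrite_closed_RL assms(2)] RL_EQ by blast+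
  then have "(s', t) \<in> EQ" using EQ_trans[of s' t' t] st(3) simB_EQ by blast
  then show "(s, t) \<in> EQ" using EQ_trans[of s s' t] st(1) simB_EQ by blast
qed

lemma IA_step_backward:
  assumes "IA_step B gt S S'" and gt: "snd S \<subseteq> gt" and S': "fst S' \<subseteq> EQ" "snd S' \<subseteq> RL"
  shows "fst S \<subseteq> EQ \<and> snd S \<subseteq> RL"
  using assms(1)
proof cases
  case (orient e E s t R)
  then have "(s, t) \<in> EQ" using S'(2) RL_EQ by auto
  then have "e \<in> EQ" using orient EQ_sym by auto
  then show ?thesis using S' orient by auto
next
  case (simplify e E s t u R)
  then have "(s, u) \<in> EQ" "(s, u) \<in> gt"
    using gt S'(2) rel_mod_EQ[of R] rel_mod_subset_gt[of R] by auto
  moreover have "(u, t) \<in> EQ" using simplify S'(1) by auto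
  ultimately have "(s, t) \<in> EQ" using EQ_trans[of s u t] by blast
  then have "e \<in> EQ" using simplify EQ_sym by auto
  then show ?thesis using S' simplify by auto
next
  case (collapse s t R u E)
  then have "(s, u) \<in> RL" using S'(2) rstep_least[OF rewrite_closed_RL, of "R - {(s, t)}"] by auto
  moreover have "(u, t) \<in> EQ" "(s, t) \<in> gt" using collapse S'(1) gt by auto
  ultimately have "(s, t) \<in> RL" by (rule RL_trans)
  then show ?thesis using S' collapse by auto
next
  case (compose s t R u E)
  then have "(t, u) \<in> EQ" using gt S'(2) rel_mod_EQ[of "R - {(s, t)}"] by auto
  then have "(u, t) \<in> EQ" by (rule EQ_sym)
  moreover have "(s, u) \<in> RL" "(s, t) \<in> gt" using compose S'(2) gt by auto
  ultimately have "(s, t) \<in> RL" using RL_trans by blast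
  then show ?thesis using S' compose by auto
qed (use S' simB_EQ in auto)

lemma run_backward:
  assumes run: "is_run B gt E run n" and final: "fst (run n) \<subseteq> EQ" "snd (run n) \<subseteq> RL" and "i \<le> n"
  shows "fst (run i) \<subseteq> EQ \<and> snd (run i) \<subseteq> RL"
  using \<open>i \<le> n\<close>
proof (induction rule: inc_induct)
  case base
  show ?case using final by simp
next
  case (step i)
  then have "IA_step B gt (run i) (run (Suc i))" using run by (simp add: is_run_def)
  moreover have "snd (run i) \<subseteq> gt" using run_rules_gt[OF run] step(2) by simp
  ultimately show ?case using step.IH by (intro IA_step_backward) auto
qed

end

context compatible_order
begin

lemma backward_invariant_conv:
  assumes "B \<subseteq> conv T"
  shows "backward_invariant B gt (conv T) (conv T)"
  using conv_least[OF assms] rewrite_closed_conv sym_conv conv_trans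
  by unfold_locales (auto simp: simB_def)

lemma run_conv_eq:
  assumes run: "is_run B gt E run n" and E_n: "fst (run n) = {}"
  shows "conv (E \<union> B) = conv (snd (run n) \<union> B)"
proof (intro equalityI conv_least)
  let ?T = "snd (run n) \<union> B"
  have T: "snd (run n) \<subseteq> conv ?T" "B \<subseteq> conv ?T" using subset_conv[of ?T] by auto
  then have "fst (run 0) \<subseteq> conv ?T"
    using backward_invariant.run_backward[OF backward_invariant_conv run, of ?T 0] E_n by simp
  then show "E \<union> B \<subseteq> conv ?T" using run T(2) by (simp add: is_run_def)
  show "?T \<subseteq> conv (E \<union> B)"
    using run_subset_conv[OF run, of n] subset_conv[of "E \<union> B"] by auto
qed

end

context compatible_trs
begin

lemma backward_invariant_connected: "backward_invariant B gt connected simulated"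
  using rewrite_closed_simulated sym_connected simulated_subset_connected simB_subset_connected
    connected_trans simulated_trans
  by unfold_locales

lemma run_connected:
  assumes "is_run B gt E run n" "fst (run n) = {}" "snd (run n) = R" "i \<le> n"
  shows "fst (run i) \<subseteq> connected" "snd (run i) \<subseteq> simulated"
  using backward_invariant.run_backward[OF backward_invariant_connected assms(1) _ _ assms(4)]
    assms(2,3) subset_rstep[of R] rstep_subset_simulated by auto

lemma fair_run_prime_critical_pairs_connected:
  assumes inf: "infinite (UNIV :: 'v set)"
    and run: "is_run B gt E run n" "fst (run n) = {}" "snd (run n) = R" and fair: "fair B run n"
  shows "prime_critical_pairs_connected B gt R"
proof
  have simulated: "sstep (snd (run i)) \<subseteq> simulated \<union> simulated\<inverse>" if "i \<le> n" for i
    using run_connected(2)[OF run that]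
    by (intro sstep_least rewrite_closed_Un rewrite_closed_converse rewrite_closed_simulated)
      (auto simp: sym_def)
  have connected: "sstep (fst (run i) \<union> snd (run i)) \<subseteq> connected" if "i \<le> n" for i
    using run_connected[OF run that] simulated_subset_connected
    by (intro sstep_least rewrite_closed_connected sym_connected) auto
  show "PCP R \<subseteq> connected"
    using fair connected join_mod_subset_connected unfolding fair_def run(3) by blast
  show "PCP_pm R B \<subseteq> join_mod R B \<union> (simulated \<union> simulated\<inverse>)"
    using fair simulated unfolding fair_def run(3) by blast
qed (use inf fair in \<open>simp_all add: fair_def run(3)\<close>)

end

theorem theorem4p12:
  fixes E B :: "('f, 'v) rule set" and gt :: "('f, 'v) trm rel"
    and run :: "nat \<Rightarrow> ('f, 'v) state" and n :: nat
  assumes "infinite (UNIV :: 'v set)"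
    and "\<forall>(l, r) \<in> B. vars l = vars r"
    and "B_compatible_reduction_order B gt"
    and "is_run B gt E run n"
    and "fair B run n"
    and "\<not> fails run n"
  shows "conv (E \<union> B) = conv (snd (run n) \<union> B)
       \<and> terminating_mod (snd (run n)) B
       \<and> CR_mod (snd (run n)) B"
proof -
  interpret compatible_order B gt using assms(3) by unfold_locales
  have E_n: "fst (run n) = {}" using assms(6) by (simp add: fails_def)
  have R_gt: "snd (run n) \<subseteq> gt" using run_rules_gt[OF assms(4)] by simp
  interpret compatible_trs B gt "snd (run n)" using R_gt by unfold_locales
  interpret prime_critical_pairs_connected B gt "snd (run n)"
    using assms(1,4) E_n refl assms(5) by (rule fair_run_prime_critical_pairs_connected)
  show ?thesis
    using run_conv_eq[OF assms(4) E_n] terminating_modI[OF R_gt] Church_Rosser by blast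
qed

end
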